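(* Let $K:[0,\infty)\to V_1$ be bounded and locally integrable, $\ell(t)=\int_0^tK(s)\,ds$, and $H_k[T]=H_k[\ell|_{[0,T]}]$. Let $\mathbf T=(T_j)$ be a scale sequence ($T_j\to\infty$) such that, with $\ell_T(u)=(\ell(Tu)-\ell(0))/T$, $$\ell_{T_j}\longrightarrow\ell^\infty$$ uniformly on $[0,1]$, with $\sup_j\operatorname{Var}(\ell_{T_j};[0,1])<\infty$. Then, for every $1\le k\le n$, the diagonal limit $\Lambda_k^{(k)}(\mathbf T)=\lim_{j\to\infty}H_k[T_j]/T_j^k$ exists and $$\Lambda_k^{(k)}(\mathbf T)=H_k[\ell^\infty].$$ Consequently, whenever the input $K$ is period-admissible through step $r$ along $\mathbf T$, the diagonal of its sequential period array is exactly the homogeneous logarithmic development of the macroscopic path $\ell^\infty$ arising along that sequence, i.e. $\Lambda_k^{(k)}(\mathbf T)=H_k[\ell^\infty]$ for $1\le k\le r$.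
   Context: Graded setting. $\mathfrak g=V_1\oplus\cdots\oplus V_n$ is a finite-dimensional real graded $n$-step nilpotent Lie algebra: $[V_i,V_j]\subseteq V_{i+j}$, $V_k=\{0\}$ for $k>n$, generated as a Lie algebra by $V_1$, with a fixed norm $\|\cdot\|$. $\operatorname{Var}(\gamma;[a,b])=\sup\sum_i\|\gamma(t_i)-\gamma(t_{i-1})\|$ over partitions; $\gamma$ is BV if this is finite. Chacon–Fomenko Lie integral $H[\gamma]$ of a continuous BV path $\gamma:[a,b]\to V_1$. Define iterated Riemann–Stieltjes integrals $I_1(\gamma)_{s,t}=\gamma(t)-\gamma(s)$, $I_q(\gamma)_{s,t}=\int_s^t d\gamma(u)\otimes I_{q-1}(\gamma)_{s,u}\in V_1^{\otimes q}$ for $q\ge2$. Let $B_q:V_1^{\otimes q}\to V_q$ be the linear map with $B_1(v)=v$, $B_q(v_1\otimes\cdots\otimes v_q)=[\cdots[[v_1,v_2],v_3],\ldots,v_q]$, and put $T_j[\gamma]=B_{j+1}(I_{j+1}(\gamma)_{a,b})$, $j\ge0$. Let $k_{2p}=b_{2p}/(2p)!$ with $b_{2p}$ the Bernoulli numbers. Then $H[\gamma]=H_1[\gamma]+\cdots+H_n[\gamma]$, $H_k[\gamma]\in V_k$, is defined by $H_1[\gamma]=T_0[\gamma]=\gamma(b)-\gamma(a)$ and, for $k\ge1$, $$(k+1)H_{k+1}[\gamma]=T_k[\gamma]+\sum_{r=1}^k\Big\{\tfrac12[H_r[\gamma],T_{k-r}[\gamma]]+\sum_{p\ge1,\,2p\le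 r}k_{2p}\sum_{m_i>0,\;m_1+\cdots+m_{2p}=r}[H_{m_1}[\gamma],[\cdots[H_{m_{2p}}[\gamma],T_{k-r}[\gamma]]\cdots]]\Big\}.$$ Period array. For fixed $k$, the coefficients are defined successively, whenever the limits exist, by $\Lambda_k^{(k)}(\mathbf T)=\lim_jH_k[T_j]/T_j^k$ and, for $1\le m<k$, $$\Lambda_k^{(m)}(\mathbf T)=\lim_{j\to\infty}\frac{H_k[T_j]-\sum_{q=m+1}^kT_j^q\Lambda_k^{(q)}(\mathbf T)}{T_j^m}.$$ $K$ is period-admissible through step $r$ along $\mathbf T$ if all these limits exist for $1\le m\le k\le r$; the family $\{\Lambda_k^{(m)}(\mathbf T):1\le m\le k\le r\}$ is then the sequential (Chacon–Fomenko) period array, with diagonal the entries $m=k$. *)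

theory Defs
  imports "HOL-Analysis.Analysis"
begin

section \<open>Graded nilpotent Lie algebras\<close>

definition lie_bracket :: "('g::real_vector \<Rightarrow> 'g \<Rightarrow> 'g) \<Rightarrow> bool" where
  "lie_bracket br \<longleftrightarrow>
     bilinear br \<and> (\<forall>x. br x x = 0) \<and>
     (\<forall>x y z. br x (br y z) + br y (br z x) + br z (br x y) = 0)"

definition lie_subalgebra :: "('g::real_vector \<Rightarrow> 'g \<Rightarrow> 'g) \<Rightarrow> 'g set \<Rightarrow> bool" where
  "lie_subalgebra br S \<longleftrightarrow> subspace S \<and> (\<forall>x\<in>S. \<forall>y\<in>S. br x y \<in> S)"

text \<open>The Lie algebra is the whole type; its layers are \<open>V 1, \<dots>, V n\<close>.
  The value \<open>V 0\<close> is irrelevant.\<close>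

definition graded_nilpotent_lie_algebra ::
    "('g::real_vector \<Rightarrow> 'g \<Rightarrow> 'g) \<Rightarrow> (nat \<Rightarrow> 'g set) \<Rightarrow> nat \<Rightarrow> bool" where
  "graded_nilpotent_lie_algebra br V n \<longleftrightarrow>
     lie_bracket br \<and>
     (\<exists>B::'g set. finite B \<and> span B = UNIV) \<and>
     1 \<le> n \<and>
     (\<forall>k\<ge>1. subspace (V k)) \<and>
     (\<forall>x. \<exists>!f. f \<in> (\<Pi>\<^sub>E k\<in>{1..n}. V k) \<and> x = (\<Sum>k=1..n. f k)) \<and>
     (\<forall>k>n. V k = {0}) \<and>
     (\<forall>i\<ge>1. \<forall>j\<ge>1. \<forall>x\<in>V i. \<forall>y\<in>V j. br x y \<in> V (i + j)) \<and>
     lie_subalgebra br hull V 1 = UNIV"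


section \<open>Variation and Riemann--Stieltjes integrals\<close>

definition variation :: "(real \<Rightarrow> 'a::real_normed_vector) \<Rightarrow> real \<Rightarrow> real \<Rightarrow> ereal" where
  "variation \<gamma> a b =
     (SUP d\<in>{d. d division_of {a..b}}. ereal (\<Sum>k\<in>d. norm (\<gamma> (Sup k) - \<gamma> (Inf k))))"

text \<open>The gauge is constant, so this is the Riemann--Stieltjes (mesh) limit and not a
  Henstock--Stieltjes integral.\<close>

definition has_rs_integral ::
    "(real \<Rightarrow> real) \<Rightarrow> (real \<Rightarrow> real) \<Rightarrow> real \<Rightarrow> real \<Rightarrow> real \<Rightarrow> bool" where
  "has_rs_integral f g s t I \<longleftrightarrow>
     (\<forall>\<epsilon>>0. \<exists>\<delta>>0. \<forall>p. p tagged_division_of {s..t} \<and> (\<lambda>x. ball x \<delta>) fine p \<longrightarrow>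
        \<bar>(\<Sum>(x, k)\<in>p. f x * (g (Sup k) - g (Inf k))) - I\<bar> < \<epsilon>)"

definition rs_integral :: "(real \<Rightarrow> real) \<Rightarrow> (real \<Rightarrow> real) \<Rightarrow> real \<Rightarrow> real \<Rightarrow> real" where
  "rs_integral f g s t = (THE I. has_rs_integral f g s t I)"


section \<open>Tensor powers of the first layer\<close>

text \<open>Throughout, \<open>E\<close> is a basis of \<open>V 1\<close>. A tensor of degree \<open>q\<close> over \<open>V 1\<close> is
  represented by its coordinates in the basis
  \<open>e\<^sub>1 \<otimes> \<cdots> \<otimes> e\<^sub>q\<close> (\<open>e\<^sub>i \<in> E\<close>), that is, by a real function of the word
  \<open>[e\<^sub>1, \<dots>, e\<^sub>q]\<close>.\<close>

type_synonym 'g tensor = "'g list \<Rightarrow> real"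

primrec elementary_tensor :: "'g::real_vector set \<Rightarrow> 'g list \<Rightarrow> 'g tensor" where
  "elementary_tensor E [] = (\<lambda>w. if w = [] then 1 else 0)"
| "elementary_tensor E (v # vs) =
     (\<lambda>w. case w of [] \<Rightarrow> 0 | e # w' \<Rightarrow> representation E v e * elementary_tensor E vs w')"

text \<open>The integral \<open>\<integral> d\<gamma>(u) \<otimes> F(u)\<close> over \<open>[s, t]\<close>: its coordinate at
  \<open>e \<otimes> w\<close> is the scalar integral of the \<open>w\<close>-coordinate of \<open>F\<close> against the
  \<open>e\<close>-coordinate of \<open>\<gamma>\<close>.\<close>

definition tensor_rs_integral ::
    "'g::real_vector set \<Rightarrow> (real \<Rightarrow> 'g) \<Rightarrow> (real \<Rightarrow> 'g tensor) \<Rightarrow> real \<Rightarrow> real \<Rightarrow> 'g tensor" where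
  "tensor_rs_integral E \<gamma> F s t =
     (\<lambda>w. case w of [] \<Rightarrow> 0
          | e # w' \<Rightarrow> rs_integral (\<lambda>u. F u w') (\<lambda>u. representation E (\<gamma> u) e) s t)"

fun iterated_integral ::
    "'g::real_vector set \<Rightarrow> (real \<Rightarrow> 'g) \<Rightarrow> nat \<Rightarrow> real \<Rightarrow> real \<Rightarrow> 'g tensor" where
  "iterated_integral E \<gamma> 0 s t = elementary_tensor E []"
| "iterated_integral E \<gamma> (Suc 0) s t = elementary_tensor E [\<gamma> t - \<gamma> s]"
| "iterated_integral E \<gamma> (Suc (Suc q)) s t =
     tensor_rs_integral E \<gamma> (\<lambda>u. iterated_integral E \<gamma> (Suc q) s u) s t"

definition left_normed_bracket :: "('g \<Rightarrow> 'g \<Rightarrow> 'g) \<Rightarrow> 'g list \<Rightarrow> 'g" where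
  "left_normed_bracket br vs = foldl br (hd vs) (tl vs)"

text \<open>The linear map \<open>B\<^sub>q\<close>, given by its values on the basis tensors; its values on
  arbitrary elementary tensors are computed in \<open>tensor_bracket_elementary\<close> below.\<close>

definition tensor_bracket ::
    "('g::real_vector \<Rightarrow> 'g \<Rightarrow> 'g) \<Rightarrow> 'g set \<Rightarrow> nat \<Rightarrow> 'g tensor \<Rightarrow> 'g" where
  "tensor_bracket br E q \<tau> =
     (\<Sum>w | length w = q \<and> set w \<subseteq> E. \<tau> w *\<^sub>R left_normed_bracket br w)"

lemma foldl_bracket_expand:
  fixes br :: "'g::real_vector \<Rightarrow> 'g \<Rightarrow> 'g"
  assumes "bilinear br" "independent E" "finite E" "set vs \<subseteq> span E"
  shows "(\<Sum>w | length w = length vs \<and> set w \<subseteq> E. elementary_tensor E vs w *\<^sub>R foldl br x w)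
           = foldl br x vs"
  using assms(4)
proof (induction vs arbitrary: x)
  case Nil
  have "{w. length w = length ([]::'g list) \<and> set w \<subseteq> E} = {[]}" by auto
  then show ?case by simp
next
  case (Cons v vs)
  let ?W = "{w. length w = length vs \<and> set w \<subseteq> E}"
  have W: "{w. length w = length (v # vs) \<and> set w \<subseteq> E} = (\<lambda>(e, w). e # w) ` (E \<times> ?W)"
    by (auto simp: length_Suc_conv)
  have inj: "inj_on (\<lambda>(e, w). e # w) (E \<times> ?W)" by (auto simp: inj_on_def)
  have "linear (br x)" using assms(1) by (simp add: bilinear_def)
  have "linear (\<lambda>y. foldl br y vs)"
  proof (induction vs)
    case Nil
    show ?case by (simp add: linear_iff)
  next
    case (Cons a vs)
    have "linear (\<lambda>y. br y a)" using assms(1) by (simp add: bilinear_def)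
    from linear_compose[OF this Cons] show ?case by (simp add: o_def)
  qed
  with \<open>linear (br x)\<close> have lin: "linear (\<lambda>y. foldl br (br x y) vs)"
    using linear_compose[of "br x" "\<lambda>y. foldl br y vs"] by (simp add: o_def)
  have "(\<Sum>w | length w = length (v # vs) \<and> set w \<subseteq> E.
            elementary_tensor E (v # vs) w *\<^sub>R foldl br x w)
      = (\<Sum>(e, w)\<in>E \<times> ?W. (representation E v e * elementary_tensor E vs w)
            *\<^sub>R foldl br (br x e) w)"
    unfolding W sum.reindex[OF inj] by (simp add: o_def case_prod_beta)
  also have "\<dots> = (\<Sum>e\<in>E. representation E v e *\<^sub>R
                     (\<Sum>w\<in>?W. elementary_tensor E vs w *\<^sub>R foldl br (br x e) w))"
    by (simp add: sum.cartesian_product[symmetric] scaleR_sum_right)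
  also have "\<dots> = (\<Sum>e\<in>E. representation E v e *\<^sub>R foldl br (br x e) vs)"
    using Cons by simp
  also have "\<dots> = foldl br (br x (\<Sum>e\<in>E. representation E v e *\<^sub>R e)) vs"
    using linear_sum[OF lin, of "\<lambda>e. representation E v e *\<^sub>R e" E] by (simp add: linear_cmul[OF lin])
  also have "(\<Sum>e\<in>E. representation E v e *\<^sub>R e) = v"
    using Cons.prems assms by (intro real_vector.sum_representation_eq) auto
  finally show ?case by simp
qed

lemma tensor_bracket_elementary:
  fixes br :: "'g::real_vector \<Rightarrow> 'g \<Rightarrow> 'g"
  assumes "bilinear br" "independent E" "finite E" "set vs \<subseteq> span E" "vs \<noteq> []"
  shows "tensor_bracket br E (length vs) (elementary_tensor E vs) = left_normed_bracket br vs"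
proof -
  obtain v us where vs: "vs = v # us" using assms(5) by (cases vs) auto
  let ?W = "{w. length w = length us \<and> set w \<subseteq> E}"
  have W: "{w. length w = length vs \<and> set w \<subseteq> E} = (\<lambda>(e, w). e # w) ` (E \<times> ?W)"
    by (auto simp: length_Suc_conv vs)
  have inj: "inj_on (\<lambda>(e, w). e # w) (E \<times> ?W)" by (auto simp: inj_on_def)
  have lin: "linear (\<lambda>y. foldl br y us)"
  proof (induction us)
    case Nil
    show ?case by (simp add: linear_iff)
  next
    case (Cons a us)
    have "linear (\<lambda>y. br y a)" using assms(1) by (simp add: bilinear_def)
    from linear_compose[OF this Cons] show ?case by (simp add: o_def)
  qed
  have "tensor_bracket br E (length vs) (elementary_tensor E vs)
      = (\<Sum>(e, w)\<in>E \<times> ?W. (representation E v e * elementary_tensor E us w) *\<^sub>R foldl br e w)"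
    unfolding tensor_bracket_def W sum.reindex[OF inj]
    by (simp add: o_def case_prod_beta vs left_normed_bracket_def)
  also have "\<dots> = (\<Sum>e\<in>E. representation E v e *\<^sub>R
                     (\<Sum>w\<in>?W. elementary_tensor E us w *\<^sub>R foldl br e w))"
    by (simp add: sum.cartesian_product[symmetric] scaleR_sum_right)
  also have "\<dots> = (\<Sum>e\<in>E. representation E v e *\<^sub>R foldl br e us)"
    using foldl_bracket_expand[OF assms(1-3)] assms(4) vs by simp
  also have "\<dots> = foldl br (\<Sum>e\<in>E. representation E v e *\<^sub>R e) us"
    using linear_sum[OF lin, of "\<lambda>e. representation E v e *\<^sub>R e" E] by (simp add: linear_cmul[OF lin])
  also have "(\<Sum>e\<in>E. representation E v e *\<^sub>R e) = v"
    using assms vs by (intro real_vector.sum_representation_eq) auto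
  finally show ?thesis by (simp add: vs left_normed_bracket_def)
qed


section \<open>The Chacon--Fomenko Lie integral\<close>

fun bernoulli :: "nat \<Rightarrow> real" where
  "bernoulli n =
     (if n = 0 then 1
      else - (\<Sum>k<n. real (Suc n choose k) * bernoulli k) / real (Suc n))"

declare bernoulli.simps [simp del]

text \<open>The recursion for the homogeneous parts \<open>H\<^sub>k\<close> in terms of the sequence
  \<open>T\<^sub>0, T\<^sub>1, \<dots>\<close>. The list \<open>ms\<close> is \<open>[m\<^sub>1, \<dots>, m\<^bsub>2p\<^esub>]\<close>. The case \<open>k = 0\<close> of the second
  equation is \<open>H\<^sub>1 = T\<^sub>0\<close>.\<close>

function lie_log :: "('g::real_vector \<Rightarrow> 'g \<Rightarrow> 'g) \<Rightarrow> (nat \<Rightarrow> 'g) \<Rightarrow> nat \<Rightarrow> 'g" where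
  "lie_log br T 0 = 0"
| "lie_log br T (Suc k) = (1 / real (k + 1)) *\<^sub>R
     (T k + (\<Sum>r\<in>{1..k}.
        (1 / 2) *\<^sub>R br (lie_log br T r) (T (k - r)) +
        (\<Sum>p | 1 \<le> p \<and> 2 * p \<le> r.
           (bernoulli (2 * p) / fact (2 * p)) *\<^sub>R
           (\<Sum>ms | length ms = 2 * p \<and> (\<forall>m\<in>set ms. 0 < m) \<and> sum_list ms = r.
              foldr (\<lambda>m x. br (lie_log br T m) x) ms (T (k - r))))))"
  by pat_completeness auto
termination
  by (relation "Wellfounded.measure (\<lambda>(br, T, k). k)")
     (auto dest!: member_le_sum_list simp: less_Suc_eq_le)

definition lie_integral ::
    "('g::real_vector \<Rightarrow> 'g \<Rightarrow> 'g) \<Rightarrow> 'g set \<Rightarrow> (real \<Rightarrow> 'g) \<Rightarrow> real \<Rightarrow> real \<Rightarrow> nat \<Rightarrow> 'g" where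
  "lie_integral br E \<gamma> a b =
     lie_log br (\<lambda>j. tensor_bracket br E (Suc j) (iterated_integral E \<gamma> (Suc j) a b))"


section \<open>Period arrays\<close>

text \<open>Here \<open>h k T\<close> stands for \<open>H\<^sub>k[T]\<close>, and \<open>T\<close> below is the scale sequence.\<close>

function period_coeff ::
    "(nat \<Rightarrow> real \<Rightarrow> 'g::real_normed_vector) \<Rightarrow> (nat \<Rightarrow> real) \<Rightarrow> nat \<Rightarrow> nat \<Rightarrow> 'g" where
  "period_coeff h T k m =
     lim (\<lambda>j. (h k (T j) - (\<Sum>q\<in>{m<..k}. T j ^ q *\<^sub>R period_coeff h T k q)) /\<^sub>R T j ^ m)"
  by pat_completeness auto
termination
  by (relation "Wellfounded.measure (\<lambda>(h, T, k, m). k - m)") auto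

declare period_coeff.simps [simp del]

definition period_admissible ::
    "(nat \<Rightarrow> real \<Rightarrow> 'g::real_normed_vector) \<Rightarrow> (nat \<Rightarrow> real) \<Rightarrow> nat \<Rightarrow> bool" where
  "period_admissible h T r \<longleftrightarrow>
     (\<forall>k m. 1 \<le> m \<and> m \<le> k \<and> k \<le> r \<longrightarrow>
        convergent (\<lambda>j. (h k (T j) - (\<Sum>q\<in>{m<..k}. T j ^ q *\<^sub>R period_coeff h T k q))
                          /\<^sub>R T j ^ m))"


section \<open>Paths driven by an input\<close>

text \<open>The sort constraints are those of the Bochner integral; every finite-dimensional normed
  space satisfies them.\<close>

definition primitive ::
    "(real \<Rightarrow> 'g::{banach, second_countable_topology}) \<Rightarrow> real \<Rightarrow> 'g" where
  "primitive K t = (LINT s:{0..t}|lebesgue. K s)"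

definition rescaled_path ::
    "(real \<Rightarrow> 'g::real_normed_vector) \<Rightarrow> real \<Rightarrow> real \<Rightarrow> 'g" where
  "rescaled_path l T u = (l (T * u) - l 0) /\<^sub>R T"

end

theory Submission
  imports Defs
begin

text \<open>Since \<open>K\<close> is bounded, all paths involved are uniformly Lipschitz, and so are the iterated
  integrals \<open>u \<mapsto> I\<^sub>q(\<gamma>)\<^bsub>0,u\<^esub>\<close>, with constants depending only on that of \<open>\<gamma>\<close>. For Lipschitz
  \<open>f\<close>, \<open>g\<close> the Riemann--Stieltjes sums over tagged divisions of mesh \<open>\<delta>\<close> differ from the integral by
  \<open>O(\<delta>)\<close>, with a constant depending only on the Lipschitz constants; hence the integral is continuous
  under pointwise convergence with uniform Lipschitz bounds, and by induction so are the iterated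
  integrals and the polynomial expressions \<open>H\<^sub>k\<close> in them. Homogeneity
  \<open>H\<^sub>k[\<ell>\<^sub>T] = H\<^sub>k[T] / T\<^sup>k\<close> then gives the diagonal limit.\<close>

section \<open>Riemann--Stieltjes integrals of Lipschitz functions\<close>

text \<open>The increment of \<open>g\<close> over \<open>k \<inter> l\<close>. Clamping the endpoints of \<open>l\<close> to \<open>k\<close> gives \<open>0\<close> when the
  intersection is empty, and makes the sum over all \<open>l\<close> in a division telescope.\<close>

definition overlap_increment :: "(real \<Rightarrow> real) \<Rightarrow> real set \<Rightarrow> real set \<Rightarrow> real" where
  "overlap_increment g k l =
     g (max (Inf k) (min (Sup k) (Sup l))) - g (max (Inf k) (min (Sup k) (Inf l)))"

text \<open>For overlapping intervals both sides are \<open>g (min d v) - g (max c u)\<close>; for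
  disjoint ones both are 0.\<close>

lemma overlap_increment_commute:
  assumes "c \<le> d" "u \<le> v"
  shows "overlap_increment g {c..d} {u..v} = overlap_increment g {u..v} {c..d}"
  using assms by (auto simp: overlap_increment_def max_def min_def)

lemma sum_overlap_increment:
  assumes "q tagged_division_of {a..b}" "c \<le> d" "a \<le> c" "d \<le> b"
  shows "(\<Sum>(y, l)\<in>q. overlap_increment g {c..d} l) = g d - g c"
proof -
  have "(\<Sum>(y, l)\<in>q. g (max c (min d (Sup l))) - g (max c (min d (Inf l))))
      = g (max c (min d b)) - g (max c (min d a))"
    using additive_tagged_division_1[of a b q "\<lambda>x. g (max c (min d x))"] assms by simp
  moreover have "max c (min d b) = d" "max c (min d a) = c" using assms by auto
  ultimately show ?thesis using assms by (simp add: overlap_increment_def)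
qed

lemma tagged_division_of_realE:
  fixes a b :: real
  assumes "p tagged_division_of {a..b}" "(x, k) \<in> p"
  obtains c d where "k = {c..d}" "c \<le> d" "a \<le> c" "d \<le> b" "x \<in> {c..d}"
proof -
  obtain c d where k: "k = cbox c d" using tagged_division_ofD(4)[OF assms] by blast
  have "x \<in> k" "k \<subseteq> {a..b}" using tagged_division_ofD(2,3)[OF assms] by blast+
  then show ?thesis using that[of c d] k by auto
qed

abbreviation rs_sum :: "(real \<Rightarrow> real) \<Rightarrow> (real \<Rightarrow> real) \<Rightarrow> (real \<times> real set) set \<Rightarrow> real" where
  "rs_sum f g p \<equiv> (\<Sum>(x, k)\<in>p. f x * (g (Sup k) - g (Inf k)))"

text \<open>The common refinement of \<open>p\<close> and \<open>q\<close> is never built as a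
  division: pairs of cells index it, and empty intersections contribute 0. Each piece keeps its tag
  from \<open>p\<close>.\<close>

lemma rs_sum_refine:
  assumes p: "p tagged_division_of {a..b}" and q: "q tagged_division_of {a..b}"
  shows "rs_sum f g p = (\<Sum>(x, k)\<in>p. \<Sum>(y, l)\<in>q. f x * overlap_increment g k l)"
proof (rule sum.cong[OF refl], safe)
  fix x k assume "(x, k) \<in> p"
  then obtain c d where k: "k = {c..d}" "c \<le> d" "a \<le> c" "d \<le> b"
    using tagged_division_of_realE[OF p] by metis
  show "f x * (g (Sup k) - g (Inf k)) = (\<Sum>(y, l)\<in>q. f x * overlap_increment g k l)"
    using sum_overlap_increment[OF q k(2-4), of g] k
    by (simp add: case_prod_unfold sum_distrib_left[symmetric])
qed

text \<open>With the identity as integrator, \<open>overlap_increment\<close> is the length of the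
  intersection.\<close>

lemma overlap_increment_bound:
  assumes g: "M-lipschitz_on {a..b} g"
    and "c \<le> d" "a \<le> c" "d \<le> b" "u \<le> v"
  shows "\<bar>overlap_increment g {c..d} {u..v}\<bar> \<le> M * overlap_increment (\<lambda>x. x) {c..d} {u..v}"
proof -
  let ?s = "max c (min d v)" and ?t = "max c (min d u)"
  have "?s \<in> {a..b}" "?t \<in> {a..b}" "?t \<le> ?s" using assms by auto
  then show ?thesis
    using lipschitz_on_normD[OF g, of ?s ?t] assms by (simp add: overlap_increment_def)
qed

text \<open>On the common refinement the two sums differ only in their tags. Cells that meet have
  tags at distance at most \<open>2 * \<delta>\<close>, so a piece contributes at most
  \<open>2 * L * \<delta> * M\<close> times its length, and the lengths add up to
  \<open>b - a\<close>.\<close>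

lemma rs_sum_diff_bound:
  assumes f: "L-lipschitz_on {a..b} f" and g: "M-lipschitz_on {a..b} g" and "a \<le> b"
    and p: "p tagged_division_of {a..b}" "(\<lambda>x. ball x \<delta>) fine p"
    and q: "q tagged_division_of {a..b}" "(\<lambda>x. ball x \<delta>) fine q"
  shows "\<bar>rs_sum f g p - rs_sum f g q\<bar> \<le> 2 * L * M * (b - a) * \<delta>"
proof -
  have L: "0 \<le> L" by (rule lipschitz_on_nonneg[OF f])
  \<comment> \<open>Symmetry of the overlap puts both sums over the same pieces with the same
    increments.\<close>
  have qswap: "rs_sum f g q = (\<Sum>(x, k)\<in>p. \<Sum>(y, l)\<in>q. f y * overlap_increment g k l)"
  proof -
    have "rs_sum f g q = (\<Sum>(y, l)\<in>q. \<Sum>(x, k)\<in>p. f y * overlap_increment g l k)"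
      by (rule rs_sum_refine[OF q(1) p(1)])
    also have "\<dots> = (\<Sum>(y, l)\<in>q. \<Sum>(x, k)\<in>p. f y * overlap_increment g k l)"
    proof (intro sum.cong[OF refl], safe, intro sum.cong[OF refl], safe)
      fix y l x k assume "(y, l) \<in> q" "(x, k) \<in> p"
      then show "f y * overlap_increment g l k = f y * overlap_increment g k l"
        by (metis overlap_increment_commute tagged_division_of_realE[OF p(1)]
            tagged_division_of_realE[OF q(1)])
    qed
    finally show ?thesis
      by (simp add: case_prod_unfold) (rule sum.swap)
  qed
  have term_bound: "\<bar>(f x - f y) * overlap_increment g k l\<bar>
      \<le> (2 * L * \<delta> * M) * overlap_increment (\<lambda>x. x) k l"
    if xk: "(x, k) \<in> p" and yl: "(y, l) \<in> q" for x k y l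
  proof -
    obtain c d where k: "k = {c..d}" "c \<le> d" "a \<le> c" "d \<le> b" "x \<in> {c..d}"
      using tagged_division_of_realE[OF p(1) xk] by metis
    obtain u v where l: "l = {u..v}" "u \<le> v" "a \<le> u" "v \<le> b" "y \<in> {u..v}"
      using tagged_division_of_realE[OF q(1) yl] by metis
    have bd: "\<bar>overlap_increment g k l\<bar> \<le> M * overlap_increment (\<lambda>x. x) k l"
      unfolding k(1) l(1) using overlap_increment_bound[OF g] k l by blast
    show ?thesis
    proof (cases "max c u \<le> min d v")
      case True
      \<comment> \<open>The left endpoint of the intersection is a point of both cells, so each tag
        is within \<open>\<delta>\<close> of it.\<close>
      then have "max c u \<in> k" "max c u \<in> l" using k l by auto
      then have "\<bar>x - max c u\<bar> < \<delta>" "\<bar>y - max c u\<bar> < \<delta>"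
        using p(2) q(2) xk yl by (auto simp: fine_def dist_real_def subset_iff)
      then have "\<bar>x - y\<bar> \<le> 2 * \<delta>" by linarith
      moreover have "\<bar>f x - f y\<bar> \<le> L * \<bar>x - y\<bar>"
        using lipschitz_on_normD[OF f, of x y] k l by simp
      ultimately have "\<bar>f x - f y\<bar> \<le> 2 * L * \<delta>"
        using mult_left_mono[of "\<bar>x - y\<bar>" "2 * \<delta>" L] L by linarith
      then have "\<bar>f x - f y\<bar> * \<bar>overlap_increment g k l\<bar>
          \<le> (2 * L * \<delta>) * (M * overlap_increment (\<lambda>x. x) k l)"
        using bd by (intro mult_mono) auto
      then show ?thesis by (simp add: abs_mult mult.assoc)
    next
      case False
      then have "overlap_increment h k l = 0" for h
        using k l by (auto simp: overlap_increment_def max_def min_def)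
      then show ?thesis by simp
    qed
  qed
  have "\<bar>rs_sum f g p - rs_sum f g q\<bar>
      = \<bar>\<Sum>(x, k)\<in>p. \<Sum>(y, l)\<in>q. (f x - f y) * overlap_increment g k l\<bar>"
    unfolding qswap rs_sum_refine[OF p(1) q(1)]
    by (simp add: case_prod_unfold sum_subtractf left_diff_distrib)
  also have "\<dots> \<le> (\<Sum>(x, k)\<in>p. \<Sum>(y, l)\<in>q. (2 * L * \<delta> * M) * overlap_increment (\<lambda>x. x) k l)"
    unfolding case_prod_unfold
    by (intro order_trans[OF sum_abs] sum_mono term_bound) auto
  \<comment> \<open>The refinement identity read backwards, with a constant integrand; the remaining
    sum of lengths telescopes.\<close>
  also have "\<dots> = rs_sum (\<lambda>_. 2 * L * \<delta> * M) (\<lambda>x. x) p"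
    by (rule rs_sum_refine[OF p(1) q(1), symmetric])
  also have "\<dots> = 2 * L * M * (b - a) * \<delta>"
    using additive_tagged_division_1[OF \<open>a \<le> b\<close> p(1), of "\<lambda>x. x"]
    by (simp add: case_prod_unfold sum_distrib_left[symmetric])
  finally show ?thesis .
qed

section \<open>Uniqueness and existence of the integral, with an explicit error bound\<close>

lemma fine_ball_exists:
  fixes a b \<delta> :: real
  assumes "0 < \<delta>"
  obtains p where "p tagged_division_of {a..b}" "(\<lambda>x. ball x \<delta>) fine p"
  using fine_division_exists_real[of "\<lambda>x. ball x \<delta>" a b] assms by (auto simp: gauge_def)

lemma fine_ball_mono:
  "(\<lambda>x. ball x \<delta>) fine p \<Longrightarrow> \<delta> \<le> \<delta>' \<Longrightarrow> (\<lambda>x. ball x \<delta>') fine p"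
  unfolding fine_def using subset_ball by blast

lemma has_rs_integral_unique:
  assumes "has_rs_integral f g a b I" "has_rs_integral f g a b J"
  shows "I = J"
proof (rule ccontr)
  assume "I \<noteq> J"
  then have e: "\<bar>I - J\<bar> / 2 > 0" by simp
  obtain d1 where d1: "d1 > 0" "\<forall>p. p tagged_division_of {a..b} \<and> (\<lambda>x. ball x d1) fine p \<longrightarrow>
      \<bar>rs_sum f g p - I\<bar> < \<bar>I - J\<bar> / 2"
    using assms(1)[unfolded has_rs_integral_def, rule_format, OF e] by (elim exE conjE) (rule that)
  obtain d2 where d2: "d2 > 0" "\<forall>p. p tagged_division_of {a..b} \<and> (\<lambda>x. ball x d2) fine p \<longrightarrow>
      \<bar>rs_sum f g p - J\<bar> < \<bar>I - J\<bar> / 2"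
    using assms(2)[unfolded has_rs_integral_def, rule_format, OF e] by (elim exE conjE) (rule that)
  obtain p where p: "p tagged_division_of {a..b}" "(\<lambda>x. ball x (min d1 d2)) fine p"
    using fine_ball_exists[of "min d1 d2" a b] d1 d2 by auto
  have "(\<lambda>x. ball x d1) fine p" "(\<lambda>x. ball x d2) fine p"
    using fine_ball_mono[OF p(2)] by auto
  then show False using d1(2)[rule_format, of p] d2(2)[rule_format, of p] p(1) by argo
qed

lemma rs_integral_eqI: "has_rs_integral f g a b I \<Longrightarrow> rs_integral f g a b = I"
  unfolding rs_integral_def by (rule the_equality) (auto intro: has_rs_integral_unique)

lemma has_rs_integralI_linear_error:
  assumes "\<And>\<delta> p. 0 < \<delta> \<Longrightarrow> p tagged_division_of {a..b} \<Longrightarrow> (\<lambda>x. ball x \<delta>) fine p \<Longrightarrow>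
      \<bar>rs_sum f g p - I\<bar> \<le> C * \<delta>"
  shows "has_rs_integral f g a b I"
  unfolding has_rs_integral_def
proof (intro allI impI)
  fix e :: real assume "e > 0"
  \<comment> \<open>No sign is assumed for \<open>C\<close>, hence the absolute value; adding 1
    covers \<open>C = 0\<close>.\<close>
  define d where "d = e / (\<bar>C\<bar> + 1)"
  have "d > 0" and "C * d < e"
  proof -
    show d: "d > 0" using \<open>e > 0\<close> by (simp add: d_def add_nonneg_pos)
    have "e = \<bar>C\<bar> * d + d" by (simp add: d_def field_simps add_nonneg_eq_0_iff)
    moreover have "C * d \<le> \<bar>C\<bar> * d" using d by (intro mult_right_mono) auto
    ultimately show "C * d < e" using d by linarith
  qed
  then show "\<exists>\<delta>>0. \<forall>p. p tagged_division_of {a..b} \<and> (\<lambda>x. ball x \<delta>) fine p \<longrightarrow>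
      \<bar>rs_sum f g p - I\<bar> < e"
    using assms by (intro exI[of _ d]) (auto intro: le_less_trans)
qed

text \<open>Existence is part of the claim, since \<open>rs_integral\<close> is a definite
  description. The sums along divisions of mesh \<open>1 / (n + 1)\<close> form a Cauchy sequence by
  the comparison of two fine sums; their limit inherits the bound and is therefore the
  integral.\<close>

lemma rs_sum_error:
  assumes f: "L-lipschitz_on {a..b} f" and g: "M-lipschitz_on {a..b} g" and ab: "a \<le> b"
    and p: "p tagged_division_of {a..b}" "(\<lambda>x. ball x \<delta>) fine p" "0 < \<delta>"
  shows "\<bar>rs_sum f g p - rs_integral f g a b\<bar> \<le> 2 * L * M * (b - a) * \<delta>"
proof -
  let ?C = "2 * L * M * (b - a)"
  have "\<forall>n. \<exists>p. p tagged_division_of {a..b} \<and> (\<lambda>x. ball x (inverse (real (Suc n)))) fine p"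
    by (metis fine_ball_exists inverse_positive_iff_positive of_nat_0_less_iff zero_less_Suc)
  then obtain P where P: "\<And>n. P n tagged_division_of {a..b}"
      "\<And>n. (\<lambda>x. ball x (inverse (real (Suc n)))) fine P n" by metis
  let ?S = "\<lambda>n. rs_sum f g (P n)"
  have null: "(\<lambda>n. ?C * inverse (real (Suc n))) \<longlonglongrightarrow> 0"
    by (rule tendsto_mult_right_zero[OF LIMSEQ_inverse_real_of_nat])
  have diff: "\<bar>?S m - ?S n\<bar> \<le> ?C * inverse (real (Suc n))" if "n \<le> m" for m n
    using that by (intro rs_sum_diff_bound[OF f g ab P(1) _ P(1) P(2)] fine_ball_mono[OF P(2)]) auto
  have "Cauchy ?S"
  proof (rule metric_CauchyI)
    fix e :: real assume "e > 0"
    then obtain N where N: "?C * inverse (real (Suc N)) < e / 2"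
      using order_tendstoD(2)[OF null, of "e / 2"] by (auto simp: eventually_sequentially)
    have "dist (?S m) (?S n) < e" if "m \<ge> N" "n \<ge> N" for m n
      using diff[of N m] diff[of N n] that N unfolding dist_real_def by linarith
    then show "\<exists>M. \<forall>m\<ge>M. \<forall>n\<ge>M. dist (?S m) (?S n) < e" by blast
  qed
  then obtain I where I: "?S \<longlonglongrightarrow> I" by (meson Cauchy_convergent convergent_def)
  \<comment> \<open>Once \<open>1 / (n + 1) < \<delta>\<close>, the division \<open>P n\<close> is
    also \<open>\<delta>\<close>-fine, so the comparison with it survives the limit in
    \<open>n\<close>.\<close>
  have err: "\<bar>rs_sum f g p - I\<bar> \<le> ?C * \<delta>"
    if "p tagged_division_of {a..b}" "(\<lambda>x. ball x \<delta>) fine p" "0 < \<delta>" for p \<delta>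
  proof (rule tendsto_upperbound)
    show "(\<lambda>n. \<bar>rs_sum f g p - ?S n\<bar>) \<longlonglongrightarrow> \<bar>rs_sum f g p - I\<bar>"
      by (intro tendsto_intros I)
    have "\<forall>\<^sub>F n in sequentially. inverse (real (Suc n)) < \<delta>"
      using order_tendstoD(2)[OF LIMSEQ_inverse_real_of_nat] that by blast
    then show "\<forall>\<^sub>F n in sequentially. \<bar>rs_sum f g p - ?S n\<bar> \<le> ?C * \<delta>"
    proof eventually_elim
      case (elim n)
      then show ?case
        by (intro rs_sum_diff_bound[OF f g ab that(1,2) P(1)] fine_ball_mono[OF P(2)]) auto
    qed
  qed simp
  then have "has_rs_integral f g a b I" by (rule has_rs_integralI_linear_error)
  then show ?thesis using err[OF p] by (simp add: rs_integral_eqI)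
qed

section \<open>Additivity over intervals, local behaviour and change of variables\<close>

lemma rs_sum_Un:
  assumes p: "p tagged_division_of {a..c}" and q: "q tagged_division_of {c..b}"
  shows "rs_sum f g (p \<union> q) = rs_sum f g p + rs_sum f g q"
proof (rule sum.union_inter_neutral)
  \<comment> \<open>A tagged cell common to both divisions can only be the degenerate
    \<open>{c..c}\<close>, so counting it once or twice makes no difference.\<close>
  show "\<forall>x\<in>p \<inter> q. (case x of (x, k) \<Rightarrow> f x * (g (Sup k) - g (Inf k))) = 0"
  proof safe
    fix x k assume "(x, k) \<in> p" "(x, k) \<in> q"
    then obtain u v u' v' where "k = {u..v}" "u \<le> v" "v \<le> c" "k = {u'..v'}" "u' \<le> v'" "c \<le> u'"
      by (metis tagged_division_of_realE[OF p] tagged_division_of_realE[OF q])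
    then have "k = {c..c}" by auto
    then show "f x * (g (Sup k) - g (Inf k)) = 0" by simp
  qed
qed (use p q tagged_division_of_finite in auto)

lemma rs_integral_combine:
  assumes f: "L-lipschitz_on {a..b} f" and g: "M-lipschitz_on {a..b} g"
    and c: "a \<le> c" "c \<le> b"
  shows "rs_integral f g a b = rs_integral f g a c + rs_integral f g c b"
proof -
  let ?D = "\<bar>rs_integral f g a b - (rs_integral f g a c + rs_integral f g c b)\<bar>"
  have ab: "a \<le> b" using c by simp
  \<comment> \<open>The union of fine divisions of the two halves is fine for the whole interval.
    The three errors carry the lengths \<open>b - a\<close>, \<open>c - a\<close> and
    \<open>b - c\<close>, which gives the factor 4; then \<open>\<delta>\<close> tends to 0.\<close>
  have "?D \<le> 4 * L * M * (b - a) * \<delta>" if \<delta>: "0 < \<delta>" for \<delta>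
  proof -
    obtain p where p: "p tagged_division_of {a..c}" "(\<lambda>x. ball x \<delta>) fine p"
      using fine_ball_exists[OF \<delta>] by blast
    obtain q where q: "q tagged_division_of {c..b}" "(\<lambda>x. ball x \<delta>) fine q"
      using fine_ball_exists[OF \<delta>] by blast
    have "p \<union> q tagged_division_of {a..c} \<union> {c..b}"
      by (rule tagged_division_Un[OF p(1) q(1)]) (simp add: interior_atLeastAtMost_real)
    then have pq: "p \<union> q tagged_division_of {a..b}" using c by (simp add: ivl_disj_un_two_touch)
    have "\<bar>rs_sum f g (p \<union> q) - rs_integral f g a b\<bar> \<le> 2 * L * M * (b - a) * \<delta>"
      by (rule rs_sum_error[OF f g ab pq fine_Un[OF p(2) q(2)] \<delta>])
    moreover have "\<bar>rs_sum f g p - rs_integral f g a c\<bar> \<le> 2 * L * M * (c - a) * \<delta>"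
      using c by (intro rs_sum_error[OF lipschitz_on_subset[OF f] lipschitz_on_subset[OF g] _ p \<delta>]) auto
    moreover have "\<bar>rs_sum f g q - rs_integral f g c b\<bar> \<le> 2 * L * M * (b - c) * \<delta>"
      using c by (intro rs_sum_error[OF lipschitz_on_subset[OF f] lipschitz_on_subset[OF g] _ q \<delta>]) auto
    ultimately have "?D \<le> 2 * L * M * (b - a) * \<delta> + 2 * L * M * (c - a) * \<delta> + 2 * L * M * (b - c) * \<delta>"
      unfolding rs_sum_Un[OF p(1) q(1)] by linarith
    then show ?thesis by (simp add: algebra_simps)
  qed
  moreover have "((\<lambda>\<delta>. 4 * L * M * (b - a) * \<delta>) \<longlongrightarrow> 4 * L * M * (b - a) * 0) (at_right 0)"
    by (intro tendsto_intros)
  ultimately have "?D \<le> 4 * L * M * (b - a) * 0"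
    by (intro tendsto_lowerbound[of "\<lambda>\<delta>. 4 * L * M * (b - a) * \<delta>" _ "at_right 0"])
      (auto simp: eventually_at_filter)
  then show ?thesis by simp
qed

text \<open>The error bound for the division of \<open>{u..v}\<close> into a single cell tagged at
  \<open>u\<close>. An open ball of radius \<open>v - u\<close> around \<open>u\<close> would miss
  \<open>v\<close>, so the mesh is taken as \<open>2 * (v - u)\<close>, which yields the factor
  4.\<close>

lemma rs_integral_local:
  assumes f: "L-lipschitz_on {a..b} f" and g: "M-lipschitz_on {a..b} g"
    and uv: "a \<le> u" "u \<le> v" "v \<le> b"
  shows "\<bar>rs_integral f g a v - rs_integral f g a u - f u * (g v - g u)\<bar> \<le> 4 * L * M * (v - u)\<^sup>2"
proof (cases "u = v")
  case False
  then have "{(u, {u..v})} tagged_division_of {u..v}"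
    using uv by (intro tagged_division_of_self_real) auto
  moreover have "(\<lambda>x. ball x (2 * (v - u))) fine {(u, {u..v})}"
    using False uv by (auto simp: fine_def dist_real_def)
  ultimately have "\<bar>rs_sum f g {(u, {u..v})} - rs_integral f g u v\<bar> \<le> 2 * L * M * (v - u) * (2 * (v - u))"
    using uv False by (intro rs_sum_error[OF lipschitz_on_subset[OF f] lipschitz_on_subset[OF g]]) auto
  moreover have "rs_integral f g a v = rs_integral f g a u + rs_integral f g u v"
    using uv by (intro rs_integral_combine[OF lipschitz_on_subset[OF f] lipschitz_on_subset[OF g]]) auto
  ultimately show ?thesis using uv by (simp add: power2_eq_square algebra_simps)
qed simp

text \<open>The local estimate characterizes the indefinite integral; this replaces the transport of tagged
  divisions in the change of variables below.\<close>

lemma rs_integral_eqI_local: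
  assumes f: "L-lipschitz_on {a..b} f" and g: "M-lipschitz_on {a..b} g" and ab: "a \<le> b"
    and J0: "J a = 0"
    and J: "\<And>u v. a \<le> u \<Longrightarrow> u \<le> v \<Longrightarrow> v \<le> b \<Longrightarrow>
      \<bar>J v - J u - f u * (g v - g u)\<bar> \<le> C * (v - u)\<^sup>2"
  shows "rs_integral f g a b = J b"
proof (rule rs_integral_eqI, rule has_rs_integralI_linear_error)
  fix \<delta> :: real and p assume \<delta>: "0 < \<delta>" and p: "p tagged_division_of {a..b}"
    and fine: "(\<lambda>x. ball x \<delta>) fine p"
  have LM: "0 \<le> L" "0 \<le> M" using f g by (auto dest: lipschitz_on_nonneg)
  have term_bound: "\<bar>f x * (g (Sup k) - g (Inf k)) - (J (Sup k) - J (Inf k))\<bar>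
      \<le> (L * M + 2 * \<bar>C\<bar>) * \<delta> * (Sup k - Inf k)" if xk: "(x, k) \<in> p" for x k
  proof -
    obtain c d where k: "k = {c..d}" "c \<le> d" "a \<le> c" "d \<le> b" "x \<in> {c..d}"
      using tagged_division_of_realE[OF p xk] by metis
    have "c \<in> k" "d \<in> k" using k by auto
    then have x: "\<bar>x - c\<bar> < \<delta>" "\<bar>x - d\<bar> < \<delta>"
      using fine xk by (auto simp: fine_def dist_real_def subset_iff)
    have "\<bar>f x - f c\<bar> \<le> L * \<bar>x - c\<bar>" using lipschitz_on_normD[OF f, of x c] k by simp
    then have "\<bar>f x - f c\<bar> \<le> L * \<delta>"
      using mult_left_mono[of "\<bar>x - c\<bar>" \<delta> L] x LM by linarith
    moreover have "\<bar>g d - g c\<bar> \<le> M * (d - c)" using lipschitz_on_normD[OF g, of d c] k by simp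
    ultimately have "\<bar>(f x - f c) * (g d - g c)\<bar> \<le> (L * \<delta>) * (M * (d - c))"
      unfolding abs_mult using LM k \<delta> by (intro mult_mono) auto
    moreover have "\<bar>J d - J c - f c * (g d - g c)\<bar> \<le> 2 * \<bar>C\<bar> * \<delta> * (d - c)"
    proof -
      \<comment> \<open>Both endpoints are within \<open>\<delta>\<close> of the tag, so one factor
        \<open>d - c\<close> is traded for \<open>2 * \<delta>\<close>; the other is kept for
        summation.\<close>
      have "C * (d - c)\<^sup>2 \<le> \<bar>C\<bar> * ((2 * \<delta>) * (d - c))"
        unfolding power2_eq_square using k x by (intro mult_mono) auto
      then show ?thesis using J[of c d] k by (simp add: mult_ac)
    qed
    moreover have "f x * (g d - g c) - (J d - J c)
        = (f x - f c) * (g d - g c) - (J d - J c - f c * (g d - g c))"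
      by (simp add: algebra_simps)
    ultimately have "\<bar>f x * (g d - g c) - (J d - J c)\<bar>
        \<le> (L * \<delta>) * (M * (d - c)) + 2 * \<bar>C\<bar> * \<delta> * (d - c)" by linarith
    then show ?thesis using k by (simp add: algebra_simps)
  qed
  have "rs_sum f g p - J b = (\<Sum>(x, k)\<in>p. f x * (g (Sup k) - g (Inf k)) - (J (Sup k) - J (Inf k)))"
    using additive_tagged_division_1[OF ab p, of J] J0 by (simp add: case_prod_unfold sum_subtractf)
  then have "\<bar>rs_sum f g p - J b\<bar> \<le> (\<Sum>(x, k)\<in>p. (L * M + 2 * \<bar>C\<bar>) * \<delta> * (Sup k - Inf k))"
    unfolding case_prod_unfold by (auto intro!: order_trans[OF sum_abs] sum_mono term_bound)
  also have "\<dots> = (L * M + 2 * \<bar>C\<bar>) * (b - a) * \<delta>"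
    using additive_tagged_division_1[OF ab p, of "\<lambda>x. x"]
    by (simp add: case_prod_unfold sum_distrib_left[symmetric])
  finally show "\<bar>rs_sum f g p - J b\<bar> \<le> (L * M + 2 * \<bar>C\<bar>) * (b - a) * \<delta>" .
qed

text \<open>The right-hand side, as a function of the upper limit, vanishes at 0 and satisfies the
  local estimate for the substituted functions: the estimate for \<open>f\<close> and
  \<open>g\<close> between \<open>c * u\<close> and \<open>c * v\<close> only acquires the factor
  \<open>c\<^sup>2\<close>.\<close>

lemma rs_integral_rescale:
  assumes f: "L-lipschitz_on {0..c * t} f" and g: "M-lipschitz_on {0..c * t} g"
    and c: "0 \<le> c" and t: "0 \<le> t"
  shows "rs_integral (\<lambda>u. \<alpha> * f (c * u)) (\<lambda>u. \<beta> * g (c * u)) 0 t = \<alpha> * \<beta> * rs_integral f g 0 (c * t)"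
proof (rule rs_integral_eqI_local[where J = "\<lambda>u. \<alpha> * \<beta> * rs_integral f g 0 (c * u)"])
  have im: "(\<lambda>u. c * u) ` {0..t} \<subseteq> {0..c * t}" using c by (auto intro: mult_left_mono)
  have "c-lipschitz_on {0..t} (\<lambda>u. c * u)"
    using c by (intro lipschitz_onI) (auto simp: dist_real_def abs_mult right_diff_distrib[symmetric])
  note scale = lipschitz_on_compose2[OF this]
  have cmult: "(\<bar>\<gamma>\<bar> * (A * c))-lipschitz_on {0..t} (\<lambda>u. \<gamma> * h (c * u))"
    if "A-lipschitz_on {0..c * t} h" for \<gamma> A :: real and h :: "real \<Rightarrow> real"
    using lipschitz_on_cmult_real[OF scale[OF lipschitz_on_subset[OF that im]]] by simp
  show "(\<bar>\<alpha>\<bar> * (L * c))-lipschitz_on {0..t} (\<lambda>u. \<alpha> * f (c * u))" by (rule cmult[OF f])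
  show "(\<bar>\<beta>\<bar> * (M * c))-lipschitz_on {0..t} (\<lambda>u. \<beta> * g (c * u))" by (rule cmult[OF g])
  \<comment> \<open>Additivity with all three points equal to 0 reads
    \<open>x = x + x\<close>.\<close>
  have "rs_integral f g 0 0 = 0"
    using rs_integral_combine[OF lipschitz_on_subset[OF f] lipschitz_on_subset[OF g], of 0 0 0] c t
    by simp
  then show "\<alpha> * \<beta> * rs_integral f g 0 (c * 0) = 0" by simp
  fix u v assume uv: "0 \<le> u" "u \<le> v" "v \<le> t"
  have "\<bar>rs_integral f g 0 (c * v) - rs_integral f g 0 (c * u) - f (c * u) * (g (c * v) - g (c * u))\<bar>
      \<le> 4 * L * M * (c * v - c * u)\<^sup>2"
    using uv c by (intro rs_integral_local[OF f g] mult_left_mono mult_nonneg_nonneg) auto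
  then have "\<bar>\<alpha> * \<beta>\<bar> * \<bar>rs_integral f g 0 (c * v) - rs_integral f g 0 (c * u)
      - f (c * u) * (g (c * v) - g (c * u))\<bar> \<le> \<bar>\<alpha> * \<beta>\<bar> * (4 * L * M * (c * v - c * u)\<^sup>2)"
    by (intro mult_left_mono) auto
  moreover have "(c * v - c * u)\<^sup>2 = c\<^sup>2 * (v - u)\<^sup>2" by (simp add: power2_eq_square algebra_simps)
  ultimately show "\<bar>\<alpha> * \<beta> * rs_integral f g 0 (c * v) - \<alpha> * \<beta> * rs_integral f g 0 (c * u)
      - \<alpha> * f (c * u) * (\<beta> * g (c * v) - \<beta> * g (c * u))\<bar>
      \<le> (\<bar>\<alpha> * \<beta>\<bar> * (4 * L * M * c\<^sup>2)) * (v - u)\<^sup>2"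
    unfolding abs_mult[symmetric] by (simp add: algebra_simps)
qed (use t in auto)

text \<open>The Lipschitz constants do not depend on \<open>j\<close>, so one fine division
  approximates all the integrals and the limiting one within \<open>e / 3\<close>. On this fixed
  division only finitely many values enter, and pointwise convergence suffices.\<close>

lemma tendsto_rs_integral:
  assumes f: "\<And>j. L-lipschitz_on {a..b} (f j)" and g: "\<And>j. M-lipschitz_on {a..b} (g j)"
    and F: "L-lipschitz_on {a..b} F" and G: "M-lipschitz_on {a..b} G" and ab: "a \<le> b"
    and f_lim: "\<And>x. x \<in> {a..b} \<Longrightarrow> (\<lambda>j. f j x) \<longlonglongrightarrow> F x"
    and g_lim: "\<And>x. x \<in> {a..b} \<Longrightarrow> (\<lambda>j. g j x) \<longlonglongrightarrow> G x"
  shows "(\<lambda>j. rs_integral (f j) (g j) a b) \<longlonglongrightarrow> rs_integral F G a b"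
proof (rule tendstoI)
  fix e :: real assume e: "e > 0"
  let ?C = "2 * L * M * (b - a)"
  have C: "0 \<le> ?C" using lipschitz_on_nonneg[OF F] lipschitz_on_nonneg[OF G] ab by simp
  define \<delta> where "\<delta> = e / (3 * (?C + 1))"
  have \<delta>: "\<delta> > 0" using e C by (simp add: \<delta>_def)
  have "(?C + 1) * \<delta> = e / 3" using C by (simp add: \<delta>_def field_simps)
  then have C\<delta>: "?C * \<delta> < e / 3" using \<delta> by (simp add: distrib_right)
  obtain p where p: "p tagged_division_of {a..b}" "(\<lambda>x. ball x \<delta>) fine p"
    using fine_ball_exists[OF \<delta>] by blast
  have "(\<lambda>j. rs_sum (f j) (g j) p) \<longlonglongrightarrow> rs_sum F G p"
    unfolding case_prod_unfold
  proof (intro tendsto_sum)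
    fix z assume "z \<in> p"
    then obtain c d where "snd z = {c..d}" "c \<le> d" "a \<le> c" "d \<le> b" "fst z \<in> {c..d}"
      by (metis prod.collapse tagged_division_of_realE[OF p(1)])
    then show "(\<lambda>j. f j (fst z) * (g j (Sup (snd z)) - g j (Inf (snd z))))
        \<longlonglongrightarrow> F (fst z) * (G (Sup (snd z)) - G (Inf (snd z)))"
      by (intro tendsto_mult tendsto_diff f_lim g_lim) auto
  qed
  then have "\<forall>\<^sub>F j in sequentially. dist (rs_sum (f j) (g j) p) (rs_sum F G p) < e / 3"
    using e by (intro tendstoD) auto
  then show "\<forall>\<^sub>F j in sequentially. dist (rs_integral (f j) (g j) a b) (rs_integral F G a b) < e"
  proof eventually_elim
    case (elim j)
    then show ?case
      using rs_sum_error[OF f g ab p \<delta>, of j j] rs_sum_error[OF F G ab p \<delta>] C\<delta>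
      unfolding dist_real_def by linarith
  qed
qed

text \<open>In the local estimate the main term contributes \<open>A * M\<close>, and in the
  quadratic remainder one factor \<open>v - u\<close> is bounded by \<open>b - a\<close>. The
  explicit constant keeps iterated integrals uniformly Lipschitz over families of paths.\<close>

lemma rs_integral_lipschitz_bound:
  assumes f: "L-lipschitz_on {a..b} f" and g: "M-lipschitz_on {a..b} g"
    and fb: "\<And>x. x \<in> {a..b} \<Longrightarrow> \<bar>f x\<bar> \<le> A" and ab: "a \<le> b"
  shows "(A * M + 4 * L * M * (b - a))-lipschitz_on {a..b} (\<lambda>u. rs_integral f g a u)"
proof (rule lipschitz_on_leI)
  have LM: "0 \<le> L" "0 \<le> M" using f g by (auto dest: lipschitz_on_nonneg)
  have A: "0 \<le> A" using fb[of a] ab by auto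
  show "0 \<le> A * M + 4 * L * M * (b - a)" using LM A ab by simp
  fix u v assume uv: "u \<in> {a..b}" "v \<in> {a..b}" "u \<le> v"
  have "\<bar>f u * (g v - g u)\<bar> \<le> A * (M * (v - u))"
    unfolding abs_mult using fb[OF uv(1)] lipschitz_on_normD[OF g uv(2,1)] uv A
    by (intro mult_mono) auto
  moreover have "4 * L * M * (v - u)\<^sup>2 \<le> 4 * L * M * ((b - a) * (v - u))"
    unfolding power2_eq_square using LM uv by (intro mult_left_mono mult_right_mono) auto
  moreover have "\<bar>rs_integral f g a v - rs_integral f g a u - f u * (g v - g u)\<bar> \<le> 4 * L * M * (v - u)\<^sup>2"
    using uv by (intro rs_integral_local[OF f g]) auto
  ultimately have "\<bar>rs_integral f g a v - rs_integral f g a u\<bar>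
      \<le> A * (M * (v - u)) + 4 * L * M * ((b - a) * (v - u))" by linarith
  then show "dist (rs_integral f g a u) (rs_integral f g a v)
      \<le> (A * M + 4 * L * M * (b - a)) * dist u v"
    using uv by (simp add: dist_real_def abs_minus_commute algebra_simps)
qed

lemma rs_integral_cong:
  assumes "\<And>x. x \<in> {a..b} \<Longrightarrow> f x = f' x" "\<And>x. x \<in> {a..b} \<Longrightarrow> g x = g' x"
  shows "rs_integral f g a b = rs_integral f' g' a b"
proof -
  have sum_eq: "rs_sum f g p = rs_sum f' g' p" if p: "p tagged_division_of {a..b}" for p
  proof (rule sum.cong[OF refl], safe)
    fix x k assume "(x, k) \<in> p"
    then obtain c d where "k = {c..d}" "c \<le> d" "a \<le> c" "d \<le> b" "x \<in> {c..d}"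
      using tagged_division_of_realE[OF p] by metis
    then show "f x * (g (Sup k) - g (Inf k)) = f' x * (g' (Sup k) - g' (Inf k))"
      using assms by simp
  qed
  then have "has_rs_integral f g a b = has_rs_integral f' g' a b"
    unfolding has_rs_integral_def by (intro ext) (simp only: sum_eq cong: imp_cong)
  then show ?thesis by (simp add: rs_integral_def)
qed

lemma rs_integral_refl: "rs_integral f g a a = 0"
proof (rule rs_integral_eqI, rule has_rs_integralI_linear_error)
  fix p :: "(real \<times> real set) set" and \<delta> :: real assume p: "p tagged_division_of {a..a}"
  have "rs_sum f g p = 0"
  proof (rule sum.neutral, safe)
    fix x k assume "(x, k) \<in> p"
    then obtain c d where "k = {c..d}" "c \<le> d" "a \<le> c" "d \<le> a"
      using tagged_division_of_realE[OF p] by metis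
    then have "k = {a..a}" by auto
    then show "f x * (g (Sup k) - g (Inf k)) = 0" by simp
  qed
  then show "\<bar>rs_sum f g p - 0\<bar> \<le> 0 * \<delta>" by simp
qed

section \<open>Finite-dimensional normed spaces\<close>

text \<open>The bound makes the coordinates of a convergent sequence Cauchy, so they converge in the
  reals and the limit stays in the span. The bound is a hypothesis here because the induction that
  proves it uses closedness for the smaller set.\<close>

lemma closed_span_if_coordinates_bounded:
  fixes B :: "'a::real_normed_vector set"
  assumes B: "finite B" "independent B"
    and bound: "\<And>c. (\<Sum>b\<in>B. \<bar>c b\<bar>) \<le> C * norm (\<Sum>b\<in>B. c b *\<^sub>R b)"
  shows "closed (span B)"
proof (rule closed_sequential_limits[THEN iffD2], intro allI impI, elim conjE)
  fix x l assume x: "\<forall>n. x n \<in> span B" and l: "x \<longlonglongrightarrow> l"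
  define c where "c n = representation B (x n)" for n
  have x_eq: "x n = (\<Sum>b\<in>B. c n b *\<^sub>R b)" for n
    using x B by (simp add: c_def real_vector.sum_representation_eq)
  have C: "\<bar>c m b - c n b\<bar> \<le> C * norm (x m - x n)" if "b \<in> B" for m n b
  proof -
    have "\<bar>c m b - c n b\<bar> \<le> (\<Sum>b\<in>B. \<bar>c m b - c n b\<bar>)"
      using that B by (intro member_le_sum) auto
    also have "\<dots> \<le> C * norm (\<Sum>b\<in>B. (c m b - c n b) *\<^sub>R b)" by (rule bound)
    finally show ?thesis by (simp add: x_eq scaleR_left_diff_distrib sum_subtractf)
  qed
  have "convergent (\<lambda>n. c n b)" if b: "b \<in> B" for b
  proof -
    have "Cauchy (\<lambda>n. c n b)"
    proof (rule metric_CauchyI)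
      fix e :: real assume e: "e > 0"
      have "Cauchy x" using l by (rule LIMSEQ_imp_Cauchy)
      then obtain N where N: "\<And>m n. m \<ge> N \<Longrightarrow> n \<ge> N \<Longrightarrow> dist (x m) (x n) < e / (\<bar>C\<bar> + 1)"
        using e metric_CauchyD[of x "e / (\<bar>C\<bar> + 1)"] by (auto simp: add_nonneg_pos)
      have "dist (c m b) (c n b) < e" if "m \<ge> N" "n \<ge> N" for m n
      proof -
        have "C * norm (x m - x n) \<le> (\<bar>C\<bar> + 1) * norm (x m - x n)" by (intro mult_right_mono) auto
        also have "\<dots> < e" using N[OF that] by (simp add: dist_norm field_simps)
        finally show ?thesis using C[OF b, of m n] by (simp add: dist_real_def)
      qed
      then show "\<exists>M. \<forall>m\<ge>M. \<forall>n\<ge>M. dist (c m b) (c n b) < e" by blast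
    qed
    then show ?thesis by (rule Cauchy_convergent)
  qed
  then have "x \<longlonglongrightarrow> (\<Sum>b\<in>B. lim (\<lambda>n. c n b) *\<^sub>R b)"
    unfolding x_eq[abs_def] by (intro tendsto_intros) (auto simp: convergent_LIMSEQ_iff)
  then have "l = (\<Sum>b\<in>B. lim (\<lambda>n. c n b) *\<^sub>R b)" using l by (rule LIMSEQ_unique[rotated])
  also have "\<dots> \<in> span B" by (intro span_sum) (simp add: span_scale span_base)
  finally show "l \<in> span B" .
qed

text \<open>Induction on the basis: \<open>span B\<close> is closed by the previous lemma, so the
  new vector \<open>a\<close> has positive distance \<open>d\<close> from it. This bounds the
  coefficient of \<open>a\<close>; subtracting its contribution bounds the remaining ones through
  the induction hypothesis.\<close>

lemma coordinates_bounded: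
  fixes B :: "'a::real_normed_vector set"
  assumes "finite B" "independent B"
  shows "\<exists>C\<ge>0. \<forall>c. (\<Sum>b\<in>B. \<bar>c b\<bar>) \<le> C * norm (\<Sum>b\<in>B. c b *\<^sub>R b)"
  using assms
proof (induction B rule: finite_induct)
  case empty
  show ?case by (auto intro!: exI[of _ 0])
next
  case (insert a B)
  have indep: "independent B" and a: "a \<notin> span B"
    using insert.prems insert.hyps by (simp_all add: independent_insert)
  then obtain C where C: "C \<ge> 0" "\<And>c. (\<Sum>b\<in>B. \<bar>c b\<bar>) \<le> C * norm (\<Sum>b\<in>B. c b *\<^sub>R b)"
    using insert.IH by auto
  have "closed (span B)"
    by (rule closed_span_if_coordinates_bounded[OF insert.hyps(1) indep C(2)])
  then obtain d where d: "d > 0" "\<And>y. y \<in> span B \<Longrightarrow> d \<le> dist a y"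
    using a open_contains_ball[of "- span B"] by (force simp: open_closed not_less subset_iff)
  show ?case
  proof (intro exI conjI allI)
    \<comment> \<open>The term \<open>1 / d\<close> serves the coefficient of \<open>a\<close>; the
      other comes from \<open>norm v \<le> (1 + norm a / d) * norm ?x\<close>.\<close>
    let ?D = "1 / d + C * (1 + norm a / d)"
    show "0 \<le> ?D" using C d by simp
    fix c
    define v where "v = (\<Sum>b\<in>B. c b *\<^sub>R b)"
    let ?x = "c a *\<^sub>R a + v"
    have v: "v \<in> span B" unfolding v_def by (intro span_sum) (simp add: span_scale span_base)
    have ca: "\<bar>c a\<bar> * d \<le> norm ?x"
    proof (cases "c a = 0")
      case False
      \<comment> \<open>Dividing by \<open>c a\<close> turns the norm of \<open>?x\<close> into the
        distance from \<open>a\<close> to a point of \<open>span B\<close>.\<close>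
      have "d \<le> dist a (- (v /\<^sub>R c a))" by (intro d span_neg span_scale v)
      then have "\<bar>c a\<bar> * d \<le> norm (c a *\<^sub>R (a + v /\<^sub>R c a))"
        by (simp add: dist_norm mult_left_mono)
      then show ?thesis using False by (simp add: scaleR_add_right)
    qed simp
    then have ca': "\<bar>c a\<bar> \<le> norm ?x / d" using d by (simp add: field_simps)
    have "v = ?x - c a *\<^sub>R a" by simp
    then have "norm v \<le> norm ?x + \<bar>c a\<bar> * norm a" by (metis norm_scaleR norm_triangle_ineq4)
    also have "\<dots> \<le> norm ?x + norm ?x / d * norm a" using ca' by (intro add_left_mono mult_right_mono) auto
    finally have "C * norm v \<le> C * (norm ?x + norm ?x / d * norm a)" using C by (intro mult_left_mono)
    moreover have "(\<Sum>b\<in>B. \<bar>c b\<bar>) \<le> C * norm v" unfolding v_def by (rule C)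
    ultimately have "\<bar>c a\<bar> + (\<Sum>b\<in>B. \<bar>c b\<bar>) \<le> ?D * norm ?x"
      using ca' by (simp add: algebra_simps)
    then show "(\<Sum>b\<in>insert a B. \<bar>c b\<bar>) \<le> ?D * norm (\<Sum>b\<in>insert a B. c b *\<^sub>R b)"
      using insert.hyps by (simp add: v_def)
  qed
qed

lemma closed_span_finite:
  fixes B :: "'a::real_normed_vector set"
  assumes "finite B" "independent B"
  shows "closed (span B)"
proof -
  obtain C where "\<And>c. (\<Sum>b\<in>B. \<bar>c b\<bar>) \<le> C * norm (\<Sum>b\<in>B. c b *\<^sub>R b)"
    using coordinates_bounded[OF assms] by blast
  then show ?thesis by (rule closed_span_if_coordinates_bounded[OF assms])
qed

section \<open>Coordinate functionals and automatic boundedness\<close>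

lemma representation_bounded:
  fixes B :: "'a::real_normed_vector set"
  assumes B: "finite B" "independent B"
  shows "\<exists>C\<ge>0. \<forall>v\<in>span B. \<forall>b. \<bar>representation B v b\<bar> \<le> C * norm v"
proof -
  obtain C where C: "0 \<le> C" "\<And>c. (\<Sum>b\<in>B. \<bar>c b\<bar>) \<le> C * norm (\<Sum>b\<in>B. c b *\<^sub>R b)"
    using coordinates_bounded[OF B] by blast
  have "\<bar>representation B v b\<bar> \<le> C * norm v" if v: "v \<in> span B" for v b
  proof (cases "b \<in> B")
    case True
    then have "\<bar>representation B v b\<bar> \<le> (\<Sum>b\<in>B. \<bar>representation B v b\<bar>)"
      using B by (intro member_le_sum) auto
    also have "\<dots> \<le> C * norm v"
      using C(2)[of "representation B v"] B v by (simp add: real_vector.sum_representation_eq)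
    finally show ?thesis .
  next
    case False
    then have "representation B v b = 0" by (metis real_vector.representation_ne_zero)
    then show ?thesis using C by simp
  qed
  then show ?thesis using C(1) by blast
qed

lemma bounded_linear_representation:
  fixes B :: "'a::real_normed_vector set"
  assumes B: "finite B" "independent B" "span B = UNIV"
  shows "bounded_linear (\<lambda>v. representation B v b)"
proof -
  obtain C where "\<And>v. \<bar>representation B v b\<bar> \<le> C * norm v"
    using representation_bounded[OF B(1,2)] B(3) by auto
  then show ?thesis
    using B by (intro bounded_linear_intro[where K = C])
      (simp_all add: real_vector.representation_add real_vector.representation_scale mult.commute)
qed

text \<open>Describes a subspace through vanishing coordinates, a condition that passes through an
  integral.\<close>

lemma in_span_if_representation_zero:
  fixes B :: "'a::real_vector set"
  assumes B: "finite B" "independent B" "span B = UNIV" and E: "E \<subseteq> B"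
    and zero: "\<And>b. b \<in> B - E \<Longrightarrow> representation B v b = 0"
  shows "v \<in> span E"
proof -
  have "v = (\<Sum>b\<in>B. representation B v b *\<^sub>R b)"
    using B by (simp add: real_vector.sum_representation_eq)
  also have "\<dots> = (\<Sum>b\<in>E. representation B v b *\<^sub>R b)"
    using B E zero by (intro sum.mono_neutral_right) auto
  also have "\<dots> \<in> span E" by (intro span_sum) (simp add: span_scale span_base)
  finally show ?thesis .
qed

lemma bounded_bilinear_finite_dim:
  fixes br :: "'a::real_normed_vector \<Rightarrow> 'a \<Rightarrow> 'a" and B :: "'a set"
  assumes br: "bilinear br" and B: "finite B" "independent B" "span B = UNIV"
  shows "bounded_bilinear br"
proof -
  have expand: "br x y = (\<Sum>b\<in>B. \<Sum>b'\<in>B. (representation B x b * representation B y b') *\<^sub>R br b b')" for x y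
  proof -
    have "br x y = br (\<Sum>b\<in>B. representation B x b *\<^sub>R b) (\<Sum>b'\<in>B. representation B y b' *\<^sub>R b')"
      using B by (simp add: real_vector.sum_representation_eq)
    also have "\<dots> = (\<Sum>(b, b')\<in>B \<times> B. br (representation B x b *\<^sub>R b) (representation B y b' *\<^sub>R b'))"
      by (rule bilinear_sum[OF br])
    finally show ?thesis
      by (simp add: sum.cartesian_product[symmetric] bilinear_lmul[OF br] bilinear_rmul[OF br] mult.commute)
  qed
  obtain N where N: "\<And>b v. \<bar>representation B v b\<bar> \<le> norm v * N b"
    using bounded_linear.bounded[OF bounded_linear_representation[OF B]] by (metis real_norm_def)
  have "norm (br x y) \<le> norm x * norm y * (\<Sum>b\<in>B. \<Sum>b'\<in>B. N b * N b' * norm (br b b'))" for x y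
  proof -
    have "norm (br x y) \<le> (\<Sum>b\<in>B. \<Sum>b'\<in>B. (norm x * N b) * (norm y * N b') * norm (br b b'))"
      unfolding expand[of x y]
      by (intro sum_norm_le order_trans[OF norm_scaleR[THEN eq_refl]] mult_right_mono)
        (auto simp: abs_mult intro!: mult_mono N order_trans[OF abs_ge_zero N])
    then show ?thesis by (simp add: sum_distrib_left mult_ac)
  qed
  then show ?thesis
    using br by unfold_locales (auto simp: bilinear_ladd bilinear_radd bilinear_lmul bilinear_rmul)
qed

section \<open>Homogeneity and continuity of the Lie integral\<close>

lemma foldr_bilinear_scale:
  assumes br: "bilinear br"
    and X: "\<And>m. m \<in> set ms \<Longrightarrow> X' m = c ^ m *\<^sub>R X m"
  shows "foldr (\<lambda>m x. br (X' m) x) ms (c ^ k *\<^sub>R y)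
    = c ^ (sum_list ms + k) *\<^sub>R foldr (\<lambda>m x. br (X m) x) ms y"
  using X
  by (induction ms) (simp_all add: bilinear_lmul[OF br] bilinear_rmul[OF br] power_add mult_ac)

text \<open>With \<open>T i\<close> of weight \<open>i + 1\<close> and \<open>lie_log\<close> at
  \<open>m\<close> of weight \<open>m\<close>, every bracket in the recursion has weight
  \<open>r + (k' - r + 1) = Suc k'\<close>, the weights \<open>m\<close> along \<open>ms\<close>
  adding up to \<open>r\<close>.\<close>

lemma lie_log_scale:
  assumes br: "bilinear br"
  shows "lie_log br (\<lambda>i. c ^ Suc i *\<^sub>R T i) k = c ^ k *\<^sub>R lie_log br T k"
proof (induction k rule: less_induct)
  case (less k)
  let ?T = "\<lambda>i. c ^ Suc i *\<^sub>R T i"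
  show ?case
  proof (cases k)
    case (Suc k')
    have half: "br (lie_log br ?T r) (?T (k' - r)) = c ^ Suc k' *\<^sub>R br (lie_log br T r) (T (k' - r))"
      if "r \<in> {1..k'}" for r
      using that less[of r] Suc
      by (simp add: bilinear_lmul[OF br] bilinear_rmul[OF br] power_add[symmetric] del: power_Suc)
    have nest: "foldr (\<lambda>m x. br (lie_log br ?T m) x) ms (?T (k' - r))
        = c ^ Suc k' *\<^sub>R foldr (\<lambda>m x. br (lie_log br T m) x) ms (T (k' - r))"
      if "r \<in> {1..k'}" "sum_list ms = r" for r ms
    proof -
      have "lie_log br ?T m = c ^ m *\<^sub>R lie_log br T m" if "m \<in> set ms" for m
        using less[of m] member_le_sum_list[OF that] \<open>r \<in> {1..k'}\<close> \<open>sum_list ms = r\<close> Suc by simp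
      from foldr_bilinear_scale[OF br this] show ?thesis using that by (simp del: power_Suc)
    qed
    have "lie_log br ?T k = (1 / real (k' + 1)) *\<^sub>R
       (?T k' + (\<Sum>r\<in>{1..k'}.
        (1 / 2) *\<^sub>R c ^ Suc k' *\<^sub>R br (lie_log br T r) (T (k' - r)) +
        (\<Sum>p | 1 \<le> p \<and> 2 * p \<le> r.
           (bernoulli (2 * p) / fact (2 * p)) *\<^sub>R
           (\<Sum>ms | length ms = 2 * p \<and> (\<forall>m\<in>set ms. 0 < m) \<and> sum_list ms = r.
              c ^ Suc k' *\<^sub>R foldr (\<lambda>m x. br (lie_log br T m) x) ms (T (k' - r))))))"
      unfolding Suc lie_log.simps(2)
      using half nest by (intro arg_cong2[where f = scaleR] arg_cong2[where f = plus] sum.cong refl) auto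
    also have "\<dots> = c ^ Suc k' *\<^sub>R lie_log br T (Suc k')"
      unfolding lie_log.simps(2)
      by (simp add: scaleR_add_right scaleR_sum_right mult_ac del: power_Suc)
    finally show ?thesis using Suc by simp
  qed simp
qed

section \<open>Continuity of the recursion\<close>

lemma tendsto_foldr_bilinear:
  assumes br: "bounded_bilinear br"
    and X: "\<And>m. m \<in> set ms \<Longrightarrow> (\<lambda>j. X j m) \<longlonglongrightarrow> X' m" and y: "y \<longlonglongrightarrow> y'"
  shows "(\<lambda>j. foldr (\<lambda>m x. br (X j m) x) ms (y j)) \<longlonglongrightarrow> foldr (\<lambda>m x. br (X' m) x) ms y'"
  using X by (induction ms) (auto intro!: bounded_bilinear.tendsto[OF br] y)

lemma tendsto_lie_log:
  assumes br: "bounded_bilinear br"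
    and T: "\<And>i. (\<lambda>j. T j i) \<longlonglongrightarrow> T' i"
  shows "(\<lambda>j. lie_log br (T j) k) \<longlonglongrightarrow> lie_log br T' k"
proof (induction k rule: less_induct)
  case (less k)
  show ?case
  proof (cases k)
    case (Suc k')
    show ?thesis
      unfolding Suc lie_log.simps(2)
    proof (intro tendsto_scaleR tendsto_const tendsto_add tendsto_sum T bounded_bilinear.tendsto[OF br])
      fix r assume "r \<in> {1..k'}"
      then show "(\<lambda>j. lie_log br (T j) r) \<longlonglongrightarrow> lie_log br T' r" using less[of r] Suc by simp
    next
      fix r p ms
      assume r: "r \<in> {1..k'}"
        and ms: "ms \<in> {ms. length ms = 2 * p \<and> (\<forall>m\<in>set ms. 0 < m) \<and> sum_list ms = r}"
      \<comment> \<open>Entries of \<open>ms\<close> are at most their sum \<open>r\<close>, hence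
        below \<open>k\<close>, so the induction hypothesis covers them.\<close>
      have "(\<lambda>j. lie_log br (T j) m) \<longlonglongrightarrow> lie_log br T' m" if "m \<in> set ms" for m
        using less[of m] member_le_sum_list[OF that] r ms Suc by simp
      then show "(\<lambda>j. foldr (\<lambda>m x. br (lie_log br (T j) m) x) ms (T j (k' - r)))
          \<longlonglongrightarrow> foldr (\<lambda>m x. br (lie_log br T' m) x) ms (T' (k' - r))"
        by (intro tendsto_foldr_bilinear[OF br] T)
    qed
  qed simp
qed

section \<open>Iterated integrals of Lipschitz paths\<close>

lemma iterated_integral_refl: "iterated_integral E \<gamma> (Suc q) s s w = 0"
  by (cases q; cases w)
    (simp_all add: tensor_rs_integral_def rs_integral_refl real_vector.representation_zero)

text \<open>The bound is imposed on coordinates because the iterated integrals are built from scalar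
  ones. Membership in the span is included because \<open>representation\<close> is 0 off the span
  and is linear only on it.\<close>

definition lipschitz_path :: "'g::real_vector set \<Rightarrow> real \<Rightarrow> real \<Rightarrow> (real \<Rightarrow> 'g) \<Rightarrow> bool" where
  "lipschitz_path E M b \<gamma> \<longleftrightarrow> (\<forall>u\<in>{0..b}. \<gamma> u \<in> span E) \<and>
     (\<forall>e. M-lipschitz_on {0..b} (\<lambda>u. representation E (\<gamma> u) e))"

text \<open>The order of quantifiers is the point: the constant depends on the path only through
  \<open>M\<close>, so a convergent family and its limit can share it. Each integration turns a
  Lipschitz integrand into a Lipschitz function of the upper limit.\<close>

lemma iterated_integral_lipschitz:
  assumes E: "independent E" and b: "0 \<le> b"
  shows "\<exists>C. \<forall>\<gamma>. lipschitz_path E M b \<gamma> \<longrightarrow>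
    C-lipschitz_on {0..b} (\<lambda>u. iterated_integral E \<gamma> (Suc q) 0 u w)"
proof (induction q arbitrary: w)
  case 0
  show ?case
  proof (cases w)
    case Nil
    then show ?thesis by (auto intro!: exI[of _ 0] lipschitz_onI)
  next
    case (Cons e w')
    have "M-lipschitz_on {0..b} (\<lambda>u. iterated_integral E \<gamma> (Suc 0) 0 u w)"
      if \<gamma>: "lipschitz_path E M b \<gamma>" for \<gamma>
    proof -
      have M: "M-lipschitz_on {0..b} (\<lambda>u. representation E (\<gamma> u) e)"
        using \<gamma> by (simp add: lipschitz_path_def)
      have "iterated_integral E \<gamma> (Suc 0) 0 u w
          = (representation E (\<gamma> u) e - representation E (\<gamma> 0) e) * (if w' = [] then 1 else 0)"
        if "u \<in> {0..b}" for u
        using \<gamma> E b that Cons by (simp add: lipschitz_path_def real_vector.representation_diff)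
      then show ?thesis
        using lipschitz_onD[OF M] lipschitz_on_nonneg[OF M]
        by (intro lipschitz_onI) (auto simp: dist_real_def)
    qed
    then show ?thesis by blast
  qed
next
  case (Suc q)
  show ?case
  proof (cases w)
    case Nil
    then show ?thesis by (auto simp: tensor_rs_integral_def intro!: exI[of _ 0] lipschitz_onI)
  next
    case (Cons e w')
    obtain C where C: "\<And>\<gamma>. lipschitz_path E M b \<gamma> \<Longrightarrow>
        C-lipschitz_on {0..b} (\<lambda>u. iterated_integral E \<gamma> (Suc q) 0 u w')"
      using Suc.IH[of w'] by blast
    have "(C * b * M + 4 * C * M * (b - 0))-lipschitz_on {0..b}
        (\<lambda>u. iterated_integral E \<gamma> (Suc (Suc q)) 0 u w)"
      if \<gamma>: "lipschitz_path E M b \<gamma>" for \<gamma>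
    proof -
      note C\<gamma> = C[OF \<gamma>]
      \<comment> \<open>The sup bound comes for free: the iterated integral vanishes at
        \<open>u = 0\<close> and is Lipschitz.\<close>
      have "\<bar>iterated_integral E \<gamma> (Suc q) 0 u w'\<bar> \<le> C * b" if "u \<in> {0..b}" for u
      proof -
        have "\<bar>iterated_integral E \<gamma> (Suc q) 0 u w'\<bar> \<le> C * u"
          using lipschitz_on_normD[OF C\<gamma>, of u 0] that b by (simp add: iterated_integral_refl)
        also have "\<dots> \<le> C * b"
          using that lipschitz_on_nonneg[OF C\<gamma>] by (intro mult_left_mono) auto
        finally show ?thesis .
      qed
      then show ?thesis
        using rs_integral_lipschitz_bound[OF C\<gamma>, of M "\<lambda>u. representation E (\<gamma> u) e" "C * b"] \<gamma> b
        by (simp add: Cons tensor_rs_integral_def lipschitz_path_def)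
    qed
    then show ?thesis by blast
  qed
qed

text \<open>The induction carries pointwise convergence for every \<open>u\<close>, since the inner
  integral is the next integrand. The common Lipschitz constant supplies the uniformity needed to
  pass to the limit.\<close>

lemma tendsto_iterated_integral:
  assumes E: "independent E" and b: "0 \<le> b"
    and \<gamma>: "\<And>j. lipschitz_path E M b (\<gamma> j)" and \<gamma>': "lipschitz_path E M b \<gamma>'"
    and lim: "\<And>u e. u \<in> {0..b} \<Longrightarrow>
      (\<lambda>j. representation E (\<gamma> j u) e) \<longlonglongrightarrow> representation E (\<gamma>' u) e"
    and u: "u \<in> {0..b}"
  shows "(\<lambda>j. iterated_integral E (\<gamma> j) (Suc q) 0 u w) \<longlonglongrightarrow> iterated_integral E \<gamma>' (Suc q) 0 u w"
  using u
proof (induction q arbitrary: u w)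
  case 0
  show ?case
  proof (cases w)
    case (Cons e w')
    have "representation E (\<gamma> j u - \<gamma> j 0) e = representation E (\<gamma> j u) e - representation E (\<gamma> j 0) e" for j
      using \<gamma>[of j] E b 0 by (simp add: lipschitz_path_def real_vector.representation_diff)
    moreover have "representation E (\<gamma>' u - \<gamma>' 0) e = representation E (\<gamma>' u) e - representation E (\<gamma>' 0) e"
      using \<gamma>' E b 0 by (simp add: lipschitz_path_def real_vector.representation_diff)
    ultimately show ?thesis using b 0 by (auto simp: Cons intro!: tendsto_intros lim)
  qed simp
next
  case (Suc q)
  show ?case
  proof (cases w)
    case Nil
    then show ?thesis by (simp add: tensor_rs_integral_def)
  next
    case (Cons e w')
    obtain C where C: "\<And>\<gamma>. lipschitz_path E M b \<gamma> \<Longrightarrow>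
        C-lipschitz_on {0..b} (\<lambda>u. iterated_integral E \<gamma> (Suc q) 0 u w')"
      using iterated_integral_lipschitz[OF E b] by blast
    have sub: "{0..u} \<subseteq> {0..b}" using Suc.prems by auto
    have "(\<lambda>j. rs_integral (\<lambda>v. iterated_integral E (\<gamma> j) (Suc q) 0 v w') (\<lambda>v. representation E (\<gamma> j v) e) 0 u)
      \<longlonglongrightarrow> rs_integral (\<lambda>v. iterated_integral E \<gamma>' (Suc q) 0 v w') (\<lambda>v. representation E (\<gamma>' v) e) 0 u"
    proof (rule tendsto_rs_integral)
      show "C-lipschitz_on {0..u} (\<lambda>v. iterated_integral E (\<gamma> j) (Suc q) 0 v w')" for j
        by (rule lipschitz_on_subset[OF C[OF \<gamma>] sub])
      show "C-lipschitz_on {0..u} (\<lambda>v. iterated_integral E \<gamma>' (Suc q) 0 v w')"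
        by (rule lipschitz_on_subset[OF C[OF \<gamma>'] sub])
      show "M-lipschitz_on {0..u} (\<lambda>v. representation E (\<gamma> j v) e)" for j
        using \<gamma>[of j] lipschitz_on_subset[OF _ sub] by (auto simp: lipschitz_path_def)
      show "M-lipschitz_on {0..u} (\<lambda>v. representation E (\<gamma>' v) e)"
        using \<gamma>' lipschitz_on_subset[OF _ sub] by (auto simp: lipschitz_path_def)
    qed (use Suc sub lim in auto)
    then show ?thesis by (simp add: Cons tensor_rs_integral_def)
  qed
qed

text \<open>Each integrator contributes one factor \<open>inverse c\<close>, while the change of
  variables moves the upper limit to \<open>c * u\<close>. As \<open>\<gamma> 0 = 0\<close>, the
  rescaled path is just \<open>\<gamma> (c * u) /\<^sub>R c\<close>.\<close>

lemma iterated_integral_rescale: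
  assumes E: "independent E" and c: "0 < c" and \<gamma>: "lipschitz_path E M c \<gamma>" and \<gamma>0: "\<gamma> 0 = 0"
    and u: "u \<in> {0..1}"
  shows "iterated_integral E (rescaled_path \<gamma> c) (Suc q) 0 u w
    = inverse c ^ Suc q * iterated_integral E \<gamma> (Suc q) 0 (c * u) w"
  using u
proof (induction q arbitrary: u w)
  case 0
  have "c * u \<in> {0..c}" using 0 c by (auto simp: mult_left_le)
  then have "\<gamma> (c * u) \<in> span E" using \<gamma> by (auto simp: lipschitz_path_def)
  then show ?case
    using E by (cases w) (simp_all add: rescaled_path_def \<gamma>0 real_vector.representation_scale)
next
  case (Suc q)
  show ?case
  proof (cases w)
    case Nil
    then show ?thesis by (simp add: tensor_rs_integral_def)
  next
    case (Cons e w')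
    obtain C where C: "C-lipschitz_on {0..c} (\<lambda>u. iterated_integral E \<gamma> (Suc q) 0 u w')"
      using iterated_integral_lipschitz[OF E, of c] c \<gamma> by (metis less_imp_le)
    have le: "c * v \<in> {0..c}" if "v \<in> {0..u}" for v
      using that Suc.prems c by (auto simp: mult_left_le)
    have sub: "{0..c * u} \<subseteq> {0..c}" using le[of u] Suc.prems by auto
    have "rs_integral (\<lambda>v. iterated_integral E (rescaled_path \<gamma> c) (Suc q) 0 v w')
          (\<lambda>v. representation E (rescaled_path \<gamma> c v) e) 0 u
      = rs_integral (\<lambda>v. inverse c ^ Suc q * iterated_integral E \<gamma> (Suc q) 0 (c * v) w')
          (\<lambda>v. inverse c * representation E (\<gamma> (c * v)) e) 0 u"
    proof (rule rs_integral_cong)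
      fix v assume v: "v \<in> {0..u}"
      show "iterated_integral E (rescaled_path \<gamma> c) (Suc q) 0 v w'
          = inverse c ^ Suc q * iterated_integral E \<gamma> (Suc q) 0 (c * v) w'"
        using v Suc.prems by (intro Suc.IH) auto
      have "\<gamma> (c * v) \<in> span E" using \<gamma> le[OF v] by (auto simp: lipschitz_path_def)
      then show "representation E (rescaled_path \<gamma> c v) e = inverse c * representation E (\<gamma> (c * v)) e"
        using E by (simp add: rescaled_path_def \<gamma>0 real_vector.representation_scale)
    qed
    also have "\<dots> = inverse c ^ Suc q * inverse c *
        rs_integral (\<lambda>v. iterated_integral E \<gamma> (Suc q) 0 v w') (\<lambda>v. representation E (\<gamma> v) e) 0 (c * u)"
      using \<gamma> c Suc.prems
      by (intro rs_integral_rescale[OF lipschitz_on_subset[OF C sub], of M] lipschitz_on_subset[OF _ sub])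
        (auto simp: lipschitz_path_def)
    finally show ?thesis by (simp add: Cons tensor_rs_integral_def)
  qed
qed

text \<open>The sequence entering the recursion at index \<open>i\<close> comes from tensors of
  degree \<open>Suc i\<close>, so it scales by \<open>inverse c ^ Suc i\<close>, exactly the weight
  in \<open>lie_log_scale\<close>.\<close>

lemma lie_integral_rescale:
  assumes br: "bilinear br" and E: "independent E" and c: "0 < c"
    and \<gamma>: "lipschitz_path E M c \<gamma>" "\<gamma> 0 = 0"
  shows "lie_integral br E (rescaled_path \<gamma> c) 0 1 k = lie_integral br E \<gamma> 0 c k /\<^sub>R c ^ k"
proof -
  have "tensor_bracket br E (Suc i) (iterated_integral E (rescaled_path \<gamma> c) (Suc i) 0 1)
      = inverse c ^ Suc i *\<^sub>R tensor_bracket br E (Suc i) (iterated_integral E \<gamma> (Suc i) 0 c)" for i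
    unfolding tensor_bracket_def
    by (simp add: iterated_integral_rescale[OF E c \<gamma>] scaleR_sum_right del: iterated_integral.simps power_Suc)
  then show ?thesis
    unfolding lie_integral_def by (simp only: lie_log_scale[OF br] power_inverse[symmetric])
qed

lemma tendsto_lie_integral:
  assumes br: "bounded_bilinear br" and E: "independent E"
    and \<gamma>: "\<And>j. lipschitz_path E M 1 (\<gamma> j)" and \<gamma>': "lipschitz_path E M 1 \<gamma>'"
    and lim: "\<And>u e. u \<in> {0..1} \<Longrightarrow>
      (\<lambda>j. representation E (\<gamma> j u) e) \<longlonglongrightarrow> representation E (\<gamma>' u) e"
  shows "(\<lambda>j. lie_integral br E (\<gamma> j) 0 1 k) \<longlonglongrightarrow> lie_integral br E \<gamma>' 0 1 k"
  unfolding lie_integral_def tensor_bracket_def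
  by (intro tendsto_lie_log[OF br] tendsto_sum tendsto_scaleR tendsto_const
      tendsto_iterated_integral[OF E _ \<gamma> \<gamma>' lim]) auto


section \<open>Paths driven by a bounded input\<close>

lemma primitive_0: "primitive K 0 = 0"
proof -
  have "AE u in lebesgue. u \<noteq> (0::real)"
    by (rule AE_completion[OF AE_lborel_singleton])
  then have "AE u in lebesgue. indicat_real {0..0} u *\<^sub>R K u = 0"
    by (rule AE_mp) (auto simp: indicator_def)
  then show ?thesis
    unfolding primitive_def set_lebesgue_integral_def by (rule integral_eq_zero_AE)
qed

lemma primitive_diff:
  assumes K: "\<And>t. 0 \<le> t \<Longrightarrow> set_integrable lebesgue {0..t} K" and "0 \<le> s" "s \<le> t"
  shows "primitive K t - primitive K s = (LINT u:{s<..t}|lebesgue. K u)"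
proof -
  have "{0..s} \<union> {s<..t} = {0..t}" using assms by auto
  moreover have "(LINT u:{0..s} \<union> {s<..t}|lebesgue. K u)
      = (LINT u:{0..s}|lebesgue. K u) + (LINT u:{s<..t}|lebesgue. K u)"
    using assms by (intro set_integral_Un set_integrable_subset[OF K[of t]]) auto
  ultimately show ?thesis by (simp add: primitive_def)
qed

lemma primitive_lipschitz:
  assumes K: "\<And>t. 0 \<le> t \<Longrightarrow> set_integrable lebesgue {0..t} K"
    and M: "\<And>t. 0 \<le> t \<Longrightarrow> norm (K t) \<le> M"
  shows "M-lipschitz_on {0..} (primitive K)"
proof (rule lipschitz_on_leI)
  show "0 \<le> M" using order_trans[OF norm_ge_zero M[of 0]] by simp
  fix s t :: real assume st: "s \<in> {0..}" "t \<in> {0..}" "s \<le> t"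
  have "norm (LINT u:{s<..t}|lebesgue. K u) \<le> (LINT u|lebesgue. M * indicator {s<..t} u)"
    unfolding set_lebesgue_integral_def
  proof (rule Bochner_Integration.integral_norm_bound_integral)
    show "integrable lebesgue (\<lambda>u. indicat_real {s<..t} u *\<^sub>R K u)"
    proof -
      have "{s<..t} \<subseteq> {0..t}" using st by auto
      then have "set_integrable lebesgue {s<..t} K"
        using st by (intro set_integrable_subset[OF K[of t]]) auto
      then show ?thesis by (simp add: set_integrable_def)
    qed
    show "integrable lebesgue (\<lambda>u. M * indicat_real {s<..t} u)"
      using st by (intro integrable_mult_right integrable_real_indicator) auto
  qed (use st M in \<open>auto simp: indicator_def\<close>)
  also have "\<dots> = M * (t - s)" using st by simp
  finally show "dist (primitive K s) (primitive K t) \<le> M * dist s t"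
    using st primitive_diff[OF K, of s t] by (subst (1) dist_commute) (simp add: dist_norm)
qed

text \<open>A bounded functional commutes with the Bochner integral. Applied to the coordinates
  complementary to the first layer, this keeps the primitive in that layer.\<close>

lemma primitive_in_kernel:
  assumes \<phi>: "bounded_linear (\<phi> :: _ \<Rightarrow> real)"
    and K: "\<And>t. 0 \<le> t \<Longrightarrow> set_integrable lebesgue {0..t} K"
    and K0: "\<And>t. 0 \<le> t \<Longrightarrow> \<phi> (K t) = 0" and t: "0 \<le> t"
  shows "\<phi> (primitive K t) = 0"
proof -
  have "\<phi> (primitive K t) = (LINT u|lebesgue. \<phi> (indicator {0..t} u *\<^sub>R K u))"
    unfolding primitive_def set_lebesgue_integral_def
    using K[OF t] by (intro integral_bounded_linear[OF \<phi>, symmetric]) (simp add: set_integrable_def)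
  also have "(\<lambda>u. \<phi> (indicator {0..t} u *\<^sub>R K u)) = (\<lambda>u. 0)"
    using K0 linear_0[OF bounded_linear.linear[OF \<phi>]] by (auto simp: indicator_def)
  finally show ?thesis by simp
qed

lemma lipschitz_pathI:
  assumes E: "independent E" and C: "0 \<le> C"
    and bound: "\<And>v b. v \<in> span E \<Longrightarrow> \<bar>representation E v b\<bar> \<le> C * norm v"
    and \<gamma>: "M-lipschitz_on {0..b} \<gamma>" "\<And>u. u \<in> {0..b} \<Longrightarrow> \<gamma> u \<in> span E"
  shows "lipschitz_path E (C * M) b \<gamma>"
  unfolding lipschitz_path_def
proof (intro conjI allI lipschitz_onI)
  show "0 \<le> C * M" using C lipschitz_on_nonneg[OF \<gamma>(1)] by simp
  fix e u v assume uv: "u \<in> {0..b}" "v \<in> {0..b}"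
  have "\<bar>representation E (\<gamma> u - \<gamma> v) e\<bar> \<le> C * norm (\<gamma> u - \<gamma> v)"
    using uv by (intro bound span_diff \<gamma>)
  also have "\<dots> \<le> C * (M * dist u v)"
    using lipschitz_onD[OF \<gamma>(1) uv] C by (intro mult_left_mono) (auto simp: dist_norm)
  finally show "dist (representation E (\<gamma> u) e) (representation E (\<gamma> v) e) \<le> C * M * dist u v"
    using uv by (simp add: real_vector.representation_diff[OF E \<gamma>(2) \<gamma>(2)] dist_real_def mult.assoc)
qed (use \<gamma> in auto)

text \<open>\<open>E\<close> is an arbitrary basis of the first layer. Convergence is asserted
  separately from the value because \<open>period_coeff\<close> is a \<open>lim\<close>, which
  denotes something even for divergent sequences.\<close>

theorem proposition6p2:
  fixes br :: "'g::{banach, second_countable_topology} \<Rightarrow> 'g \<Rightarrow> 'g"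
    and V :: "nat \<Rightarrow> 'g set" and n :: nat and E :: "'g set"
    and K :: "real \<Rightarrow> 'g" and l linf :: "real \<Rightarrow> 'g"
    and H :: "nat \<Rightarrow> real \<Rightarrow> 'g" and T :: "nat \<Rightarrow> real"
  assumes alg: "graded_nilpotent_lie_algebra br V n"
    and basis: "independent E" "span E = V 1"
    and K_range: "\<And>t. 0 \<le> t \<Longrightarrow> K t \<in> V 1"
    and K_bounded: "bounded (K ` {0..})"
    and K_integrable: "\<And>t. 0 \<le> t \<Longrightarrow> set_integrable lebesgue {0..t} K"
    and l_def: "l = primitive K"
    and H_def: "H = (\<lambda>k t. lie_integral br E l 0 t k)"
    and T_pos: "\<And>j. 0 < T j"
    and T_lim: "filterlim T at_top sequentially"
    and l_lim: "uniform_limit {0..1} (\<lambda>j. rescaled_path l (T j)) linf sequentially"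
    and l_var: "(SUP j. variation (rescaled_path l (T j)) 0 1) < \<infinity>"
  shows "(\<forall>k. 1 \<le> k \<and> k \<le> n \<longrightarrow>
            (\<lambda>j. H k (T j) /\<^sub>R T j ^ k) \<longlonglongrightarrow> period_coeff H T k k \<and>
            period_coeff H T k k = lie_integral br E linf 0 1 k)
       \<and> (\<forall>r. r \<le> n \<and> period_admissible H T r \<longrightarrow>
            (\<forall>k. 1 \<le> k \<and> k \<le> r \<longrightarrow>
               period_coeff H T k k = lie_integral br E linf 0 1 k))"
proof -
  have bilin: "bilinear br" and "\<exists>F::'g set. finite F \<and> span F = UNIV"
    using alg by (auto simp: graded_nilpotent_lie_algebra_def lie_bracket_def)
  then obtain F :: "'g set" where F: "finite F" "span F = UNIV" by blast
  \<comment> \<open>A basis of the whole algebra extending \<open>E\<close>: it makes the bracket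
    bounded and provides everywhere defined coordinates whose vanishing detects
    \<open>span E\<close>.\<close>
  obtain B where B: "E \<subseteq> B" "independent B" "span B = UNIV"
    using maximal_independent_subset_extend[OF subset_UNIV basis(1)] by (metis top.extremum_uniqueI)
  have finB: "finite B" using independent_span_bound[OF F(1) B(2)] F(2) by simp
  then have finE: "finite E" using B(1) finite_subset by blast
  have bb: "bounded_bilinear br" by (rule bounded_bilinear_finite_dim[OF bilin finB B(2,3)])

  have l_span: "l t \<in> span E" if "0 \<le> t" for t
  proof (rule in_span_if_representation_zero[OF finB B(2,3,1)])
    fix b assume "b \<in> B - E"
    have "representation B (K u) b = 0" if "0 \<le> u" for u
    proof -
      have "K u \<in> span E" using K_range[OF that] basis(2) by simp
      then have "representation B (K u) = representation E (K u)"
        by (rule real_vector.representation_extend[OF B(2) _ B(1)])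
      then show ?thesis
        using \<open>b \<in> B - E\<close> real_vector.representation_ne_zero[of E "K u" b] by auto
    qed
    then show "representation B (l t) b = 0"
      unfolding l_def
      by (intro primitive_in_kernel[OF bounded_linear_representation[OF finB B(2,3)] K_integrable _ that])
  qed
  obtain M where M: "\<And>t. 0 \<le> t \<Longrightarrow> norm (K t) \<le> M"
    using K_bounded by (auto simp: bounded_iff)
  have l_lip: "M-lipschitz_on {0..} l"
    unfolding l_def using primitive_lipschitz[OF K_integrable M] by blast
  have M0: "0 \<le> M" by (rule lipschitz_on_nonneg[OF l_lip])
  have l0: "l 0 = 0" by (simp add: l_def primitive_0)
  let ?\<gamma> = "\<lambda>j. rescaled_path l (T j)"
  \<comment> \<open>Stretching time by \<open>T j\<close> and dividing values by \<open>T j\<close>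
    cancel, so the bound \<open>M\<close> on the input serves for every scale.\<close>
  have \<gamma>_lip: "M-lipschitz_on {0..1} (?\<gamma> j)" for j
  proof (rule lipschitz_onI[OF _ M0])
    fix u v :: real assume uv: "u \<in> {0..1}" "v \<in> {0..1}"
    have "norm (l (T j * u) - l (T j * v)) \<le> M * norm (T j * u - T j * v)"
      using uv T_pos[of j] by (intro lipschitz_on_normD[OF l_lip]) auto
    moreover have "norm (T j * u - T j * v) = T j * dist u v"
      using T_pos[of j] by (simp add: right_diff_distrib[symmetric] abs_mult dist_real_def)
    ultimately have "norm (l (T j * u) - l (T j * v)) \<le> T j * (M * dist u v)"
      by (simp add: mult.left_commute)
    moreover have "dist (?\<gamma> j u) (?\<gamma> j v) = norm (l (T j * u) - l (T j * v)) / T j"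
      using T_pos[of j]
      by (simp add: rescaled_path_def l0 dist_norm scaleR_right_diff_distrib[symmetric] divide_inverse_commute)
    ultimately show "dist (?\<gamma> j u) (?\<gamma> j v) \<le> M * dist u v"
      using T_pos[of j] by (simp add: pos_divide_le_eq mult.commute)
  qed
  have \<gamma>_span: "?\<gamma> j u \<in> span E" if "u \<in> {0..1}" for j u
    unfolding rescaled_path_def l0 diff_0_right
    using that T_pos[of j] by (intro span_scale l_span) auto
  have \<gamma>_lim: "(\<lambda>j. ?\<gamma> j u) \<longlonglongrightarrow> linf u" if "u \<in> {0..1}" for u
    using l_lim that by (rule tendsto_uniform_limitI)
  \<comment> \<open>Finite-dimensional spans are closed, so the limit path stays in the first layer;
    the Lipschitz bound passes to it pointwise as well.\<close>
  have linf_span: "linf u \<in> span E" if "u \<in> {0..1}" for u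
    by (rule closed_sequentially[OF closed_span_finite[OF finE basis(1)] \<gamma>_span[OF that] \<gamma>_lim[OF that]])
  have linf_lip: "M-lipschitz_on {0..1} linf"
  proof (rule lipschitz_onI[OF _ M0])
    fix u v :: real assume uv: "u \<in> {0..1}" "v \<in> {0..1}"
    show "dist (linf u) (linf v) \<le> M * dist u v"
      by (rule tendsto_upperbound[OF tendsto_dist[OF \<gamma>_lim[OF uv(1)] \<gamma>_lim[OF uv(2)]]])
        (use lipschitz_onD[OF \<gamma>_lip uv] in auto)
  qed

  obtain C where C: "0 \<le> C" "\<And>v b. v \<in> span E \<Longrightarrow> \<bar>representation E v b\<bar> \<le> C * norm v"
    using representation_bounded[OF finE basis(1)] by blast
  have lim: "(\<lambda>j. H k (T j) /\<^sub>R T j ^ k) \<longlonglongrightarrow> lie_integral br E linf 0 1 k" for k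
  proof -
    have "(\<lambda>j. lie_integral br E (?\<gamma> j) 0 1 k) \<longlonglongrightarrow> lie_integral br E linf 0 1 k"
    proof (rule tendsto_lie_integral[OF bb basis(1)])
      show "lipschitz_path E (C * M) 1 (?\<gamma> j)" for j
        by (rule lipschitz_pathI[OF basis(1) C \<gamma>_lip \<gamma>_span])
      show "lipschitz_path E (C * M) 1 linf"
        by (rule lipschitz_pathI[OF basis(1) C linf_lip linf_span])
      fix u e assume u: "u \<in> {0..1::real}"
      show "(\<lambda>j. representation E (?\<gamma> j u) e) \<longlonglongrightarrow> representation E (linf u) e"
      \<comment> \<open>Coordinates are dominated by the norm on \<open>span E\<close>, so
        convergence in norm gives convergence of every coordinate.\<close>
      proof (rule Lim_null[THEN iffD2], rule Lim_null_comparison)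
        show "\<forall>\<^sub>F j in sequentially. norm (representation E (?\<gamma> j u) e - representation E (linf u) e)
            \<le> C * norm (?\<gamma> j u - linf u)"
          using C(2)[OF span_diff[OF \<gamma>_span[OF u] linf_span[OF u]]]
          by (simp add: real_vector.representation_diff[OF basis(1) linf_span[OF u] \<gamma>_span[OF u]])
        show "(\<lambda>j. C * norm (?\<gamma> j u - linf u)) \<longlonglongrightarrow> 0"
          by (intro tendsto_mult_right_zero tendsto_norm_zero LIM_zero \<gamma>_lim u)
      qed
    qed
    moreover have "lie_integral br E (?\<gamma> j) 0 1 k = H k (T j) /\<^sub>R T j ^ k" for j
      unfolding H_def
    proof (rule lie_integral_rescale[where \<gamma> = l, OF bilin basis(1) T_pos _ l0])
      show "lipschitz_path E (C * M) (T j) l"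
        by (rule lipschitz_pathI[OF basis(1) C lipschitz_on_subset[OF l_lip]]) (use l_span in auto)
    qed
    ultimately show ?thesis by simp
  qed
  \<comment> \<open>On the diagonal the sum over \<open>{k<..k}\<close> is empty, which leaves the
    limit of \<open>H k (T j) /\<^sub>R T j ^ k\<close>.\<close>
  have "period_coeff H T k k = lie_integral br E linf 0 1 k" for k
    by (subst period_coeff.simps) (simp add: limI[OF lim])
  then show ?thesis using lim by simp
qed

end
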